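(* Let $p\ge 7$ be a prime, $\mathbb{K}=\overline{\mathbb{F}}_p$, and let $V$ be the irreducible non-singular curve in $\mathrm{PG}(p-2,\mathbb{K})$, defined over $\mathbb{F}_p$, given by the equations $X_1^k+X_2^k+\cdots+X_{p-1}^k=0$ for $1\le k\le p-3$, regarded as a curve in the hyperplane $X_1+\cdots+X_{p-1}=0$, which is identified (over $\mathbb{F}_p$) with $\mathrm{PG}(p-3,\mathbb{K})$. Then $V$, as a curve over $\mathbb{F}_p$, is Frobenius non-classical.
   Context: Let $\Gamma\subset\mathrm{PG}(r,\overline{\mathbb{F}}_\ell)$ be an irreducible curve defined over $\mathbb{F}_\ell$ and not contained in any hyperplane, with coordinate functions $x_0,\ldots,x_r$, let $\zeta$ be a separating variable of its function field, and let $D_\zeta^{(i)}$ denote the $i$-th Hasse derivative with respect to $\zeta$. The Frobenius order-sequence $(\nu_0,\nu_1,\ldots,\nu_{r-1})$ of $\Gamma$ (with respect to $\mathbb{F}_\ell$) is the lexicographically minimal increasing sequence of non-negative integers for which the $(r+1)\times(r+1)$ determinant with first row $(x_0^\ell,\ldots,x_r^\ell)$ and remaining rows $(D_\zeta^{(\nu_i)}x_0,\ldots,D_\zeta^{(\nu_i)}x_r)$, $0\le i\le r-1$, is non-zero. The curve is Frobenius classical if $\nu_i=i$ for all $0\le i\le r-1$, and Frobenius non-classical otherwise. Here $\ell=p$ and $r=p-3$. *)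

theory Defs
  imports
    "HOL-Library.Poly_Mapping"
    "HOL-Algebra.Algebraic_Closure_Type"
    "Berlekamp_Zassenhaus.Finite_Field"
    "Jordan_Normal_Form.Determinant"
begin

text \<open>
  A polynomial in variables \<open>X\<^sub>0, X\<^sub>1, \<dots>\<close> is a finitely supported map from exponents to
  coefficients. The function \<open>\<iota>\<close> sends the coefficients to the ring in which the polynomial is
  evaluated.
\<close>

definition mpoly_eval ::
    "('k::zero \<Rightarrow> 'b::comm_ring_1) \<Rightarrow> 'b vec \<Rightarrow> ((nat \<Rightarrow>\<^sub>0 nat) \<Rightarrow>\<^sub>0 'k) \<Rightarrow> 'b" where
  "mpoly_eval \<iota> v f =
     (\<Sum>m\<in>Poly_Mapping.keys f. \<iota> (Poly_Mapping.lookup f m) *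
        (\<Prod>j\<in>Poly_Mapping.keys m. v $ j ^ Poly_Mapping.lookup m j))"

definition homogeneous :: "nat \<Rightarrow> nat \<Rightarrow> ((nat \<Rightarrow>\<^sub>0 nat) \<Rightarrow>\<^sub>0 'k::zero) \<Rightarrow> bool" where
  "homogeneous n d f \<longleftrightarrow>
     (\<forall>m\<in>Poly_Mapping.keys f. Poly_Mapping.keys m \<subseteq> {..<n} \<and>
        (\<Sum>j\<in>Poly_Mapping.keys m. Poly_Mapping.lookup m j) = d)"

text \<open>
  Subsets of \<open>PG(r, K)\<close> are given by the set of all non-zero homogeneous coordinate vectors, of
  dimension \<open>r + 1\<close>, of their points.

  \<open>function_field_of r \<Gamma> \<iota> x\<close> says that the field \<open>'f\<close>, with \<open>K\<close> embedded by \<open>\<iota>\<close>, is the function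
  field of \<open>\<Gamma>\<close>, and that \<open>(x\<^sub>0 : \<dots> : x\<^sub>r)\<close> are its coordinate functions: \<open>x\<close> is a generic point of
  \<open>\<Gamma>\<close>, and every element of \<open>'f\<close> is a quotient of two forms of the same degree in
  \<open>x\<^sub>0, \<dots>, x\<^sub>r\<close>. This determines \<open>('f, \<iota>)\<close> up to isomorphism and \<open>x\<close> up to a common factor.
  The homogeneous ideal of \<open>\<Gamma>\<close> is then prime, i.e. the Zariski closure of \<open>\<Gamma>\<close> is irreducible.
\<close>

definition function_field_of ::
    "nat \<Rightarrow> 'k::field vec set \<Rightarrow> ('k \<Rightarrow> 'f::field) \<Rightarrow> 'f vec \<Rightarrow> bool" where
  "function_field_of r \<Gamma> \<iota> x \<longleftrightarrow>
     field_hom \<iota> \<and> x \<in> carrier_vec (r + 1) \<and>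
     (\<forall>d f. homogeneous (r + 1) d f \<longrightarrow>
        (mpoly_eval \<iota> x f = 0 \<longleftrightarrow> (\<forall>P\<in>\<Gamma>. mpoly_eval id P f = 0))) \<and>
     (\<forall>z. \<exists>d f g. homogeneous (r + 1) d f \<and> homogeneous (r + 1) d g \<and>
        mpoly_eval \<iota> x g \<noteq> 0 \<and> z = mpoly_eval \<iota> x f / mpoly_eval \<iota> x g)"

text \<open>The subfield \<open>K(\<zeta>)\<close>.\<close>

definition simple_extension :: "('k::field \<Rightarrow> 'f::field) \<Rightarrow> 'f \<Rightarrow> 'f set" where
  "simple_extension \<iota> \<zeta> =
     {poly (map_poly \<iota> f) \<zeta> / poly (map_poly \<iota> g) \<zeta> | f g. poly (map_poly \<iota> g) \<zeta> \<noteq> 0}"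

text \<open>
  \<open>\<zeta>\<close> is transcendental over \<open>K\<close>, and \<open>'f\<close> is separable algebraic over \<open>K(\<zeta>)\<close>.
  (\<open>coprime q (pderiv q)\<close> forces \<open>q \<noteq> 0\<close>, and does not depend on the field in which it is read.)
\<close>

definition separating_variable :: "('k::field \<Rightarrow> 'f::field) \<Rightarrow> 'f \<Rightarrow> bool" where
  "separating_variable \<iota> \<zeta> \<longleftrightarrow>
     (\<forall>f. f \<noteq> 0 \<longrightarrow> poly (map_poly \<iota> f) \<zeta> \<noteq> 0) \<and>
     (\<forall>z. \<exists>q. (\<forall>i. poly.coeff q i \<in> simple_extension \<iota> \<zeta>) \<and> coprime q (pderiv q) \<and>
        poly q z = 0)"

text \<open>
  \<open>D i\<close> is the \<open>i\<close>-th Hasse derivative with respect to \<open>\<zeta>\<close>. If \<open>\<zeta>\<close> is a separating variable,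
  there is exactly one such family \<open>D\<close>: the formula for the powers of \<open>\<zeta>\<close> determines it on
  \<open>K[\<zeta>]\<close>, and the product rule extends it uniquely to \<open>K(\<zeta>)\<close> and to its separable extension \<open>'f\<close>.
\<close>

definition hasse_derivatives ::
    "('k::field \<Rightarrow> 'f::field) \<Rightarrow> 'f \<Rightarrow> (nat \<Rightarrow> 'f \<Rightarrow> 'f) \<Rightarrow> bool" where
  "hasse_derivatives \<iota> \<zeta> D \<longleftrightarrow>
     D 0 = id \<and>
     (\<forall>i f g. D i (f + g) = D i f + D i g) \<and>
     (\<forall>i c f. D i (\<iota> c * f) = \<iota> c * D i f) \<and>
     (\<forall>i f g. D i (f * g) = (\<Sum>j\<le>i. D j f * D (i - j) g)) \<and>
     (\<forall>i n. D i (\<zeta> ^ n) = of_nat (n choose i) * \<zeta> ^ (n - i))"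

definition frobenius_matrix ::
    "nat \<Rightarrow> nat \<Rightarrow> (nat \<Rightarrow> 'f \<Rightarrow> 'f) \<Rightarrow> 'f::field vec \<Rightarrow> nat list \<Rightarrow> 'f mat" where
  "frobenius_matrix q r D x \<nu> =
     mat (r + 1) (r + 1) (\<lambda>(i, j). if i = 0 then (x $ j) ^ q else D (\<nu> ! (i - 1)) (x $ j))"

definition frobenius_admissible ::
    "nat \<Rightarrow> nat \<Rightarrow> (nat \<Rightarrow> 'f \<Rightarrow> 'f) \<Rightarrow> 'f::field vec \<Rightarrow> nat list \<Rightarrow> bool" where
  "frobenius_admissible q r D x \<nu> \<longleftrightarrow>
     length \<nu> = r \<and> sorted_wrt (<) \<nu> \<and> det (frobenius_matrix q r D x \<nu>) \<noteq> 0"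

definition frobenius_order_sequence ::
    "nat \<Rightarrow> nat \<Rightarrow> (nat \<Rightarrow> 'f \<Rightarrow> 'f) \<Rightarrow> 'f::field vec \<Rightarrow> nat list \<Rightarrow> bool" where
  "frobenius_order_sequence q r D x \<nu> \<longleftrightarrow>
     frobenius_admissible q r D x \<nu> \<and>
     (\<forall>\<mu>. frobenius_admissible q r D x \<mu> \<longrightarrow> \<nu> = \<mu> \<or> (\<nu>, \<mu>) \<in> lexord {(a, b). a < b})"

text \<open>
  The existence of the order-sequence (which is unique, being a lexicographic minimum) is part of
  the assertion.
\<close>

definition frobenius_nonclassical ::
    "nat \<Rightarrow> nat \<Rightarrow> (nat \<Rightarrow> 'f \<Rightarrow> 'f) \<Rightarrow> 'f::field vec \<Rightarrow> bool" where
  "frobenius_nonclassical q r D x \<longleftrightarrow>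
     (\<exists>\<nu>. frobenius_order_sequence q r D x \<nu> \<and> (\<exists>i<r. \<nu> ! i \<noteq> i))"

text \<open>The coordinates \<open>X\<^sub>1, \<dots>, X\<^bsub>p-1\<^esub>\<close> are indexed here by \<open>0, \<dots>, p - 2\<close>.\<close>

definition power_sum_curve :: "nat \<Rightarrow> 'k::field vec set" where
  "power_sum_curve p =
     {P \<in> carrier_vec (p - 1). P \<noteq> 0\<^sub>v (p - 1) \<and> (\<forall>k\<in>{1..p - 3}. (\<Sum>i<p - 1. (P $ i) ^ k) = 0)}"

definition sum_hyperplane :: "nat \<Rightarrow> 'k::field vec set" where
  "sum_hyperplane p = {P \<in> carrier_vec (p - 1). (\<Sum>i<p - 1. P $ i) = 0}"

text \<open>
  An identification, over the field \<open>'a\<close>, of the hyperplane with \<open>PG(p - 3, K)\<close>, where \<open>K\<close> is the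
  algebraic closure of \<open>'a\<close>: a matrix over \<open>'a\<close> that maps the hyperplane bijectively to
  \<open>K\<^bsup>p-2\<^esup>\<close>.
\<close>

definition hyperplane_identification :: "nat \<Rightarrow> 'a::field mat \<Rightarrow> bool" where
  "hyperplane_identification p A \<longleftrightarrow>
     A \<in> carrier_mat (p - 2) (p - 1) \<and>
     bij_betw (\<lambda>P. map_mat to_ac A *\<^sub>v P) (sum_hyperplane p) (carrier_vec (p - 2))"

end

theory Submission
  imports Defs
begin

text \<open>
  Let \<open>y\<^sub>1, \<dots>, y\<^bsub>p-1\<^esub>\<close> be the coordinate functions \<open>X\<^sub>i\<close> on the curve. Their power sums of
  exponents \<open>1, \<dots>, p - 3\<close> vanish, so by Newton's identities they are the roots of a trinomial
  \<open>T\<^bsup>p-1\<^esup> + a T + b\<close>, whence also \<open>\<Sum> y\<^sub>i\<^bsup>p+1\<^esup> = - a \<Sum> y\<^sub>i\<^sup>3 - b \<Sum> y\<^sub>i\<^sup>2 = 0\<close>. Hasse derivatives of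
  order between \<open>1\<close> and \<open>p - 1\<close> vanish on \<open>p\<close>-th powers, so for \<open>k < p\<close> we get
  \<open>\<Sum> y\<^sub>i\<^sup>p D\<^bsup>(k)\<^esup> y\<^sub>i = D\<^bsup>(k)\<^esup> (\<Sum> y\<^sub>i\<^bsup>p+1\<^esup>) = 0\<close>, and \<open>\<Sum> y\<^sub>i\<^sup>p y\<^sub>i\<^sup>p = (\<Sum> y\<^sub>i\<^sup>2)\<^sup>p = 0\<close>. Thus the vector
  \<open>(y\<^sub>i\<^sup>p)\<close>, which is not a multiple of \<open>(1, \<dots>, 1)\<close>, annihilates all rows of the determinant with
  \<open>\<nu>\<^sub>i = i\<close>, and this determinant is zero.

  A Frobenius order-sequence exists because the rows \<open>(D\<^bsup>(k)\<^esup> x\<^sub>0, \<dots>, D\<^bsup>(k)\<^esup> x\<^sub>r)\<close>, \<open>k \<ge> 0\<close>, span the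
  whole space: a linear relation among the columns, reduced at a suitable place of the function
  field, would be a linear relation between the \<open>x\<^sub>j\<close> over \<open>K\<close>. There is none because the point
  whose coordinates are the non-zero elements of \<open>F\<^sub>p\<close> lies on the curve, and so do all its
  permutations.
\<close>

section \<open>Valuation rings and places\<close>

definition subring_set :: "'a::comm_ring_1 set \<Rightarrow> bool" where
  "subring_set A \<longleftrightarrow> 1 \<in> A \<and> (\<forall>x\<in>A. \<forall>y\<in>A. x - y \<in> A \<and> x * y \<in> A)"

context
  fixes A :: "'a::comm_ring_1 set"
  assumes A: "subring_set A"
begin

lemma subring_set_1: "1 \<in> A"
  using A by (simp add: subring_set_def)

lemma subring_set_diff: "x \<in> A \<Longrightarrow> y \<in> A \<Longrightarrow> x - y \<in> A"
  using A by (simp add: subring_set_def)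

lemma subring_set_mult: "x \<in> A \<Longrightarrow> y \<in> A \<Longrightarrow> x * y \<in> A"
  using A by (simp add: subring_set_def)

lemma subring_set_0: "0 \<in> A"
  using subring_set_diff[OF subring_set_1 subring_set_1] by simp

lemma subring_set_uminus: "x \<in> A \<Longrightarrow> - x \<in> A"
  using subring_set_diff[OF subring_set_0] by fastforce

lemma subring_set_add: "x \<in> A \<Longrightarrow> y \<in> A \<Longrightarrow> x + y \<in> A"
  using subring_set_diff[OF _ subring_set_uminus] by fastforce

lemma subring_set_power: "x \<in> A \<Longrightarrow> x ^ n \<in> A"
  by (induction n) (auto intro: subring_set_1 subring_set_mult)

lemma subring_set_sum: "(\<And>i. i \<in> I \<Longrightarrow> f i \<in> A) \<Longrightarrow> (\<Sum>i\<in>I. f i) \<in> A"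
  by (induction I rule: infinite_finite_induct) (auto intro: subring_set_0 subring_set_add)

lemmas subring_set_closed =
  subring_set_0 subring_set_1 subring_set_diff subring_set_mult subring_set_uminus
  subring_set_add subring_set_power subring_set_sum

lemma subring_set_poly: "(\<And>i. poly.coeff f i \<in> A) \<Longrightarrow> x \<in> A \<Longrightarrow> poly f x \<in> A"
  unfolding poly_altdef by (intro subring_set_closed)

end

section \<open>Extension of subrings to valuation rings (Chevalley's theorem)\<close>

definition adjoin :: "'a::comm_ring_1 set \<Rightarrow> 'a \<Rightarrow> 'a set" where
  "adjoin A z = {poly f z | f. \<forall>i. poly.coeff f i \<in> A}"

lemma adjoinI: "(\<And>i. poly.coeff f i \<in> A) \<Longrightarrow> poly f z \<in> adjoin A z"
  by (auto simp: adjoin_def)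

lemma subring_set_adjoin:
  assumes A: "subring_set A"
  shows "subring_set (adjoin A z)"
  unfolding subring_set_def
proof (intro conjI ballI)
  have "poly 1 z \<in> adjoin A z"
    by (rule adjoinI) (auto simp: subring_set_closed[OF A])
  then show "1 \<in> adjoin A z" by simp
next
  fix x y assume "x \<in> adjoin A z" "y \<in> adjoin A z"
  then obtain f g where f: "x = poly f z" "\<And>i. poly.coeff f i \<in> A"
    and g: "y = poly g z" "\<And>i. poly.coeff g i \<in> A"
    by (auto simp: adjoin_def)
  have "poly (f - g) z \<in> adjoin A z"
    by (rule adjoinI) (auto intro: subring_set_closed[OF A] f g)
  then show "x - y \<in> adjoin A z" using f g by simp
  have "poly (f * g) z \<in> adjoin A z"
    by (rule adjoinI) (auto simp: coeff_mult intro: subring_set_closed[OF A] f g)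
  then show "x * y \<in> adjoin A z" using f g by simp
qed

lemma adjoin_superset: "subring_set A \<Longrightarrow> A \<subseteq> adjoin A z"
proof
  fix x assume A: "subring_set A" and "x \<in> A"
  then have "poly [:x:] z \<in> adjoin A z"
    by (intro adjoinI) (auto simp: coeff_pCons subring_set_closed[OF A] split: nat.split)
  then show "x \<in> adjoin A z" by simp
qed

lemma adjoin_self: "subring_set A \<Longrightarrow> z \<in> adjoin A z"
proof -
  assume A: "subring_set A"
  then have "poly [:0, 1:] z \<in> adjoin A z"
    by (intro adjoinI) (auto simp: coeff_pCons subring_set_closed[OF A] split: nat.split)
  then show "z \<in> adjoin A z" by simp
qed

text \<open>
  The two relations express that \<open>a\<close> becomes invertible in \<open>A[z]\<close> and in \<open>A[1/z]\<close>. The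
  relation of lower degree serves to lower the degree of the other one.
\<close>

lemma not_invertible_adjoin_both:
  fixes z :: "'a::field"
  assumes A: "subring_set A" and a: "a \<in> A" and proper: "\<And>r. r \<in> A \<Longrightarrow> a * r \<noteq> 1"
    and unit: "\<And>t. t \<in> A \<Longrightarrow> inverse (1 - a * t) \<in> A"
    and z: "z \<noteq> 0"
    and "\<And>i. poly.coeff f i \<in> A" "a * poly f z = 1"
    and "\<And>i. poly.coeff g i \<in> A" "a * poly g (inverse z) = 1"
  shows False
  using assms(5-)
proof (induction "Polynomial.degree f + Polynomial.degree g" arbitrary: z f g rule: less_induct)
  case less
  have main: False
    if z: "z \<noteq> 0"
      and fg: "\<And>i. poly.coeff f i \<in> A" "a * poly f z = 1"
        "\<And>i. poly.coeff g i \<in> A" "a * poly g (inverse z) = 1"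
      and le: "Polynomial.degree g \<le> Polynomial.degree f"
      and IH: "\<And>f'. Polynomial.degree f' < Polynomial.degree f \<Longrightarrow>
          (\<And>i. poly.coeff f' i \<in> A) \<Longrightarrow> a * poly f' z = 1 \<Longrightarrow> False" for z f g
  proof -
    define n where "n = Polynomial.degree f"
    have n0: "n > 0"
    proof (rule ccontr)
      assume "\<not> n > 0"
      then obtain c where "f = [:c:]" by (metis degree_eq_zeroE gr0I n_def)
      then show False using fg(1)[of 0] fg(2) proper by auto
    qed
    obtain g0 g1 where g: "g = pCons g0 g1" by (cases g)
    have g0: "g0 \<in> A" using fg(3)[of 0] g by simp
    have g1: "poly.coeff g1 i \<in> A" for i using fg(3)[of "Suc i"] g by simp
    have dg1: "Polynomial.degree g1 \<le> n - 1"
      using le by (auto simp: g n_def split: if_splits)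
    define u where "u = inverse (1 - a * g0)"
    have u: "u \<in> A" using unit[OF g0] by (simp add: u_def)
    have nz: "1 - a * g0 \<noteq> 0" using proper[OF g0] by auto
    have "1 - a * g0 = a * (inverse z * poly g1 (inverse z))"
      using fg(4) by (simp add: g algebra_simps)
    \<comment> \<open>The constant coefficient \<open>g0\<close> is absorbed by the unit
      \<open>1 - a * g0\<close>, which leaves a relation in positive powers of
      \<open>inverse z\<close> only.\<close>
    then have rel: "u * (a * (inverse z * poly g1 (inverse z))) = 1"
      using nz unfolding u_def by (metis left_inverse)
    define d where "d = Polynomial.degree g1"
    \<comment> \<open>Multiplied by \<open>z ^ n\<close>, the relation \<open>rel\<close> becomes
      \<open>z ^ n = a * poly h z\<close> with \<open>h\<close> of degree below \<open>n\<close>. No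
      negative exponent arises because \<open>g\<close> has degree at most \<open>n\<close>.\<close>
    define h where "h = smult u (Polynomial.monom 1 (n - 1 - d) * reflect_poly g1)"
    have ph: "poly h z = u * z ^ (n - 1) * poly g1 (inverse z)"
    proof -
      have "poly h z = u * (z ^ (n - 1 - d) * (z ^ d * poly g1 (inverse z)))"
        using z by (simp add: h_def poly_monom poly_reflect_poly_nz d_def)
      also have "z ^ (n - 1 - d) * (z ^ d * poly g1 (inverse z)) = z ^ (n - 1) * poly g1 (inverse z)"
        using dg1 by (metis d_def le_add_diff_inverse2 mult.assoc power_add)
      finally show ?thesis by (simp add: mult.assoc)
    qed
    have "a * poly h z = z ^ n * (u * (a * (inverse z * poly g1 (inverse z))))"
    proof -
      have "z ^ n = z ^ (n - 1) * z" using n0 by (metis power_minus_mult)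
      then show ?thesis using z unfolding ph by (simp add: field_simps)
    qed
    then have zn: "a * poly h z = z ^ n" using rel by simp
    have dh: "Polynomial.degree h < n"
    proof -
      have "Polynomial.degree h \<le> Polynomial.degree (Polynomial.monom (1::'a) (n - 1 - d) * reflect_poly g1)"
        by (simp add: h_def degree_smult_le)
      also have "\<dots> \<le> (n - 1 - d) + d"
        using degree_mult_le[of "Polynomial.monom (1::'a) (n - 1 - d)" "reflect_poly g1"]
          degree_monom_le[of "1::'a" "n - 1 - d"] degree_reflect_poly_le[of g1]
        by (simp add: d_def)
      also have "\<dots> < n" using dg1 n0 by (simp add: d_def)
      finally show ?thesis .
    qed
    have hA: "poly.coeff h i \<in> A" for i
      using u g1 by (auto simp: h_def coeff_monom_mult coeff_reflect_poly intro!: subring_set_closed[OF A])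
    define l where "l = poly.coeff f n"
    \<comment> \<open>The leading term \<open>l * z ^ n\<close> is replaced by
      \<open>a * l * poly h z\<close>, which has the same value, so the relation survives and the
      degree drops.\<close>
    define f' where "f' = f - Polynomial.monom l n + smult (a * l) h"
    have lA: "l \<in> A" using fg(1) by (simp add: l_def)
    have "a * poly f' z = a * poly f z - a * l * z ^ n + a * l * (a * poly h z)"
      by (simp add: f'_def poly_monom algebra_simps)
    then have f'1: "a * poly f' z = 1" using zn fg(2) by simp
    have f'A: "poly.coeff f' i \<in> A" for i
      using fg(1) lA hA a by (auto simp: f'_def intro!: subring_set_closed[OF A])
    have "poly.coeff f' i = 0" if "i \<ge> n" for i
      using that dh by (auto simp: f'_def l_def coeff_eq_0 n_def)
    then have "Polynomial.degree f' < n" using n0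
      by (metis degree_0 leading_coeff_0_iff linorder_not_less)
    then show False using IH[of f'] f'1 f'A by (simp add: n_def)
  qed
  show False
  proof (cases "Polynomial.degree g \<le> Polynomial.degree f")
    case True
    show False
      by (rule main[OF less.prems True]) (use less in \<open>auto intro: less.hyps[of _ g z]\<close>)
  next
    case False
    \<comment> \<open>The situation is symmetric under exchanging \<open>z\<close> with its inverse
      and \<open>f\<close> with \<open>g\<close>.\<close>
    have z': "inverse z \<noteq> 0" "a * poly f (inverse (inverse z)) = 1" using less.prems by auto
    show False
    proof (rule main[OF z'(1) less.prems(4,5,2) z'(2)])
      show "Polynomial.degree f \<le> Polynomial.degree g" using False by simp
      fix f' :: "'a poly"
      assume "Polynomial.degree f' < Polynomial.degree g" "\<And>i. poly.coeff f' i \<in> A"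
        "a * poly f' (inverse z) = 1"
      then show False using less.hyps[of f f' z] less.prems by auto
    qed
  qed
qed

text \<open>Zorn's lemma gives a maximal subring among those that contain \<open>R\<close> and in
  which \<open>a\<close> is not invertible. If it contained neither \<open>z\<close> nor
  \<open>inverse z\<close>, then \<open>a\<close> would become invertible on adjoining either of
  them, contrary to \<open>not_invertible_adjoin_both\<close>.\<close>

lemma valuation_ring_exists:
  fixes R :: "'a::field set"
  assumes R: "subring_set R" and a: "a \<in> R" and proper: "\<And>r. r \<in> R \<Longrightarrow> a * r \<noteq> 1"
  obtains A where "subring_set A" "R \<subseteq> A" "\<And>z. z \<in> A \<or> inverse z \<in> A"
    "\<And>r. r \<in> A \<Longrightarrow> a * r \<noteq> 1"
proof -
  define \<A> where "\<A> = {A. subring_set A \<and> R \<subseteq> A \<and> (\<forall>r\<in>A. a * r \<noteq> 1)}"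
  have "\<A> \<noteq> {}" using R proper by (auto simp: \<A>_def)
  moreover have "\<Union>C \<in> \<A>" if C: "C \<noteq> {}" "subset.chain \<A> C" for C
  proof -
    have el: "\<And>B. B \<in> C \<Longrightarrow> subring_set B \<and> R \<subseteq> B \<and> (\<forall>r\<in>B. a * r \<noteq> 1)"
      using C by (auto simp: subset.chain_def \<A>_def)
    have "subring_set (\<Union>C)"
      unfolding subring_set_def
    proof (intro conjI ballI)
      show "1 \<in> \<Union>C" using C(1) el subring_set_1 by fastforce
    next
      fix x y assume "x \<in> \<Union>C" "y \<in> \<Union>C"
      then obtain B where "B \<in> C" "x \<in> B" "y \<in> B"
        using C(2) by (auto simp: subset.chain_def) blast
      then show "x - y \<in> \<Union>C" "x * y \<in> \<Union>C"
        using el subring_set_diff subring_set_mult by blast+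
    qed
    then show ?thesis using el C(1) by (auto simp: \<A>_def)
  qed
  ultimately obtain A where A: "A \<in> \<A>" and max: "\<And>B. B \<in> \<A> \<Longrightarrow> A \<subseteq> B \<Longrightarrow> B = A"
    using subset_Zorn_nonempty[of \<A>] by blast
  have sA: "subring_set A" and RA: "R \<subseteq> A" and pA: "\<And>r. r \<in> A \<Longrightarrow> a * r \<noteq> 1"
    using A by (auto simp: \<A>_def)
  have adj: "\<exists>f. (\<forall>i. poly.coeff f i \<in> A) \<and> a * poly f z = 1" if "z \<notin> A" for z
  proof (rule ccontr)
    assume neg: "\<not> ?thesis"
    have "adjoin A z \<in> \<A>"
      using neg RA adjoin_superset[OF sA, of z] subring_set_adjoin[OF sA, of z]
      by (auto simp: \<A>_def adjoin_def)
    then show False using max adjoin_superset[OF sA, of z] adjoin_self[OF sA, of z] that by blast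
  qed
  \<comment> \<open>Were \<open>s = 1 - a * t\<close> not a unit, \<open>a\<close> would be
    invertible in A[1/s]. Multiplication by \<open>s ^ n\<close>, which is congruent to 1 modulo
    \<open>a\<close>, would bring that relation back into \<open>A\<close>.\<close>
  have unit: "inverse (1 - a * t) \<in> A" if t: "t \<in> A" for t
  proof (rule ccontr)
    assume "inverse (1 - a * t) \<notin> A"
    then obtain f where f: "\<And>i. poly.coeff f i \<in> A" and f1: "a * poly f (inverse (1 - a * t)) = 1"
      using adj by blast
    define s where "s = 1 - a * t"
    have s: "s \<noteq> 0" "s \<in> A" using pA[OF t] t RA a by (auto simp: s_def intro!: subring_set_closed[OF sA])
    have powers: "\<exists>r\<in>A. s ^ n = 1 - a * r" for n
    proof (induction n)
      case 0
      then show ?case using subring_set_0[OF sA] by (auto intro!: bexI[of _ 0])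
    next
      case (Suc n)
      then obtain r where "r \<in> A" "s ^ n = 1 - a * r" by blast
      then have "s ^ Suc n = s - a * (s * r)" "t + s * r \<in> A"
        using s t by (auto simp: right_diff_distrib mult.left_commute intro!: subring_set_closed[OF sA])
      moreover have "s - a * (s * r) = 1 - a * (t + s * r)"
        by (simp add: s_def algebra_simps)
      ultimately show ?case by auto
    qed
    define n where "n = Polynomial.degree f"
    define P where "P = poly (reflect_poly f) s"
    have P: "s ^ n * poly f (inverse s) = P"
      using s by (simp add: P_def poly_reflect_poly_nz n_def)
    have PA: "P \<in> A" unfolding P_def
      by (intro subring_set_poly[OF sA]) (auto simp: coeff_reflect_poly f s subring_set_0[OF sA])
    obtain r where r: "r \<in> A" "s ^ n = 1 - a * r" using powers by blast
    have "s ^ n = s ^ n * (a * poly f (inverse s))"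
      using f1 by (simp add: s_def)
    also have "\<dots> = a * P" using P by (simp add: mult.left_commute)
    finally have "a * P = 1 - a * r" using r(2) by simp
    then have "a * (r + P) = 1" by (simp add: distrib_left)
    moreover have "r + P \<in> A" using r(1) PA by (rule subring_set_add[OF sA])
    ultimately show False using pA by blast
  qed
  have "z \<in> A \<or> inverse z \<in> A" for z
  proof (rule ccontr)
    assume neg: "\<not> ?thesis"
    then have "z \<noteq> 0" using subring_set_0[OF sA] by auto
    moreover obtain f g where "\<And>i. poly.coeff f i \<in> A" "a * poly f z = 1"
      "\<And>i. poly.coeff g i \<in> A" "a * poly g (inverse z) = 1"
      using adj[of z] adj[of "inverse z"] neg by metis
    ultimately show False
      using not_invertible_adjoin_both[OF sA _ pA unit] RA a by blast
  qed
  then show ?thesis using that sA RA pA by blast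
qed

section \<open>Equations over K[\<zeta>], with coefficients written as values of polynomials over
  K\<close>

definition evaluate :: "('k::field \<Rightarrow> 'f::field) \<Rightarrow> 'f \<Rightarrow> 'k poly \<Rightarrow> 'f" where
  "evaluate \<iota> \<zeta> g = poly (map_poly \<iota> g) \<zeta>"

context field_hom
begin

lemma map_poly_hom_mult: "map_poly hom (f * g) = map_poly hom f * map_poly hom g"
proof -
  interpret mp: map_poly_comm_ring_hom hom ..
  show ?thesis by (rule mp.hom_mult)
qed

lemma comm_ring_hom_evaluate: "comm_ring_hom (evaluate hom \<zeta>)"
  by standard (simp_all add: evaluate_def map_poly_hom_mult map_poly_hom_add)

lemma evaluate_const [simp]: "evaluate hom \<zeta> [:c:] = hom c"
  by (simp add: evaluate_def map_poly_pCons_hom)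

lemma evaluate_linear [simp]: "evaluate hom \<zeta> [:- c, 1:] = \<zeta> - hom c"
  by (simp add: evaluate_def map_poly_pCons_hom hom_uminus)

lemma evaluate_mem:
  assumes "subring_set A" "range hom \<subseteq> A" "\<zeta> \<in> A"
  shows "evaluate hom \<zeta> g \<in> A"
  unfolding evaluate_def using assms by (intro subring_set_poly) (auto simp: coeff_map_poly)

end

lemma clear_denominators:
  fixes ev :: "'a::idom \<Rightarrow> 'b::field"
  assumes ev: "comm_ring_hom ev"
    and q: "\<And>i. \<exists>f g. poly.coeff q i = ev f / ev g \<and> ev g \<noteq> 0"
  obtains d G where "ev d \<noteq> 0" "map_poly ev G = smult (ev d) q"
proof -
  interpret comm_ring_hom ev by fact
  obtain f g where fg: "\<And>i. poly.coeff q i = ev (f i) / ev (g i)" "\<And>i. ev (g i) \<noteq> 0"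
    using q by metis
  define N where "N = Polynomial.degree q"
  define d where "d = (\<Prod>i\<le>N. g i)"
  define G where "G = (\<Sum>i\<le>N. Polynomial.monom (f i * (\<Prod>j\<in>{..N} - {i}. g j)) i)"
  have "ev d \<noteq> 0" using fg by (simp add: d_def hom_prod)
  moreover have "map_poly ev G = smult (ev d) q"
  proof (rule poly_eqI)
    fix i
    have G: "poly.coeff G i = (if i \<le> N then f i * (\<Prod>j\<in>{..N} - {i}. g j) else 0)"
      by (simp add: G_def coeff_sum if_distrib[of "\<lambda>x. x * _"] cong: if_cong)
    show "poly.coeff (map_poly ev G) i = poly.coeff (smult (ev d) q) i"
    proof (cases "i \<le> N")
      case True
      then have "d = g i * (\<Prod>j\<in>{..N} - {i}. g j)"
        unfolding d_def by (intro prod.remove) auto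
      then show ?thesis using True fg(2)[of i]
        by (simp add: coeff_map_poly G fg(1) hom_mult)
    next
      case False
      then show ?thesis by (simp add: coeff_map_poly G coeff_eq_0 N_def)
    qed
  qed
  ultimately show ?thesis using that by blast
qed

text \<open>Denominators are cleared in a separable equation over K(\<zeta>). The root is simple
  because \<open>q\<close> and \<open>pderiv q\<close> have no common linear factor.\<close>

lemma separating_variable_polynomial:
  fixes \<iota> :: "'k::field \<Rightarrow> 'f::field"
  assumes \<iota>: "field_hom \<iota>" and sep: "separating_variable \<iota> \<zeta>"
  obtains G where "poly (map_poly (evaluate \<iota> \<zeta>) G) z = 0"
    "poly (pderiv (map_poly (evaluate \<iota> \<zeta>) G)) z \<noteq> 0"
proof -
  interpret field_hom \<iota> by fact
  interpret ev: comm_ring_hom "evaluate \<iota> \<zeta>" by (rule comm_ring_hom_evaluate)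
  obtain q where q: "\<And>i. poly.coeff q i \<in> simple_extension \<iota> \<zeta>" "coprime q (pderiv q)"
    "poly q z = 0"
    using sep unfolding separating_variable_def by metis
  have "\<exists>f g. poly.coeff q i = evaluate \<iota> \<zeta> f / evaluate \<iota> \<zeta> g \<and> evaluate \<iota> \<zeta> g \<noteq> 0" for i
    using q(1)[of i] unfolding simple_extension_def evaluate_def by blast
  then obtain d G where G: "evaluate \<iota> \<zeta> d \<noteq> 0"
    "map_poly (evaluate \<iota> \<zeta>) G = smult (evaluate \<iota> \<zeta> d) q"
    by (rule clear_denominators[OF comm_ring_hom_evaluate])
  have "poly (pderiv q) z \<noteq> 0"
  proof
    assume "poly (pderiv q) z = 0"
    then have "[:- z, 1:] dvd q" "[:- z, 1:] dvd pderiv q"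
      using q(3) by (auto simp: poly_eq_0_iff_dvd)
    then have "is_unit [:- z, 1:]" using q(2) by (meson coprime_def)
    then show False by (simp add: is_unit_pCons_iff)
  qed
  then show ?thesis using that[of G] G q(3) by (simp add: pderiv_smult)
qed

section \<open>The maximal ideal of a valuation ring, and places over a point of the line\<close>

definition nonunits :: "'a::comm_ring_1 set \<Rightarrow> 'a set" where
  "nonunits A = {z \<in> A. \<forall>r\<in>A. z * r \<noteq> 1}"

context
  fixes A :: "'f::field set"
  assumes A: "subring_set A" and val: "\<And>z. z \<in> A \<or> inverse z \<in> A"
begin

lemma nonunits_mult:
  assumes "z \<in> nonunits A" "r \<in> A"
  shows "z * r \<in> nonunits A"
  unfolding nonunits_def
proof (intro CollectI conjI ballI)
  show "z * r \<in> A" using assms subring_set_mult[OF A] by (auto simp: nonunits_def)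
  fix s assume "s \<in> A"
  then have "r * s \<in> A" using assms subring_set_mult[OF A] by blast
  then show "z * r * s \<noteq> 1" using assms by (auto simp: nonunits_def mult.assoc)
qed

lemma nonunits_0: "0 \<in> nonunits A"
  by (simp add: nonunits_def subring_set_0[OF A])

text \<open>One of \<open>x / y\<close> and \<open>y / x\<close> lies in \<open>A\<close>, so the
  sum is a multiple of \<open>y\<close> or of \<open>x\<close>.\<close>

lemma nonunits_add:
  assumes "x \<in> nonunits A" "y \<in> nonunits A"
  shows "x + y \<in> nonunits A"
proof -
  have *: "x + y \<in> nonunits A"
    if "x \<in> nonunits A" "y \<in> nonunits A" "x / y \<in> A" "y \<noteq> 0" for x y
  proof -
    have "y * (x / y + 1) \<in> nonunits A"
      using that by (intro nonunits_mult subring_set_closed[OF A])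
    then show ?thesis using that by (simp add: distrib_left)
  qed
  consider "x = 0" | "y = 0" | "x \<noteq> 0" "y \<noteq> 0" by blast
  then show ?thesis
  proof cases
    case 3
    then show ?thesis
      using *[OF assms] *[OF assms(2,1)] val[of "x / y"] by (auto simp: add.commute)
  qed (use assms in auto)
qed

lemma nonunits_diff: "x \<in> nonunits A \<Longrightarrow> y \<in> nonunits A \<Longrightarrow> x - y \<in> nonunits A"
  using nonunits_add[of x "y * (-1)"] nonunits_mult[of y "-1"]
    subring_set_uminus[OF A subring_set_1[OF A]] by simp

lemma nonunits_sum: "(\<And>i. i \<in> I \<Longrightarrow> f i \<in> nonunits A) \<Longrightarrow> (\<Sum>i\<in>I. f i) \<in> nonunits A"
  by (induction I rule: infinite_finite_induct) (auto intro: nonunits_0 nonunits_add)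

lemma nonunits_prime:
  assumes "x \<in> A" "y \<in> A" "x * y \<in> nonunits A"
  shows "x \<in> nonunits A \<or> y \<in> nonunits A"
proof (rule ccontr)
  assume "\<not> ?thesis"
  then obtain r s where "r \<in> A" "s \<in> A" "x * r = 1" "y * s = 1"
    using assms by (auto simp: nonunits_def)
  moreover have "x * y * (r * s) = (x * r) * (y * s)" by (simp only: ac_simps)
  ultimately show False using assms subring_set_mult[OF A] by (auto simp: nonunits_def)
qed

lemma inverse_mem_iff_nonunit:
  assumes "z \<in> A" "z \<noteq> 0"
  shows "inverse z \<in> A \<longleftrightarrow> z \<notin> nonunits A"
proof -
  have "z * r = 1 \<longleftrightarrow> r = inverse z" for r
    using assms(2) by (metis inverse_unique right_inverse)
  then show ?thesis using assms(1) by (auto simp: nonunits_def)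
qed

end

text \<open>As \<zeta> is transcendental, \<open>\<zeta> - \<iota> c0\<close> is not invertible in
  K[\<zeta>], so some valuation ring \<open>A\<close> above K[\<zeta>] has it in its maximal ideal.
  The residue field is algebraic over the algebraically closed field K, hence equal to K. The
  residue map is \<open>\<phi>\<close>; its values outside \<open>A\<close> carry no
  meaning.\<close>

lemma place_exists:
  fixes \<iota> :: "'k::alg_closed_field \<Rightarrow> 'f::field"
  assumes \<iota>: "field_hom \<iota>" and sep: "separating_variable \<iota> \<zeta>"
  obtains A \<phi> where "subring_set A" "range \<iota> \<subseteq> A" "\<zeta> \<in> A" "\<And>z. z \<in> A \<or> inverse z \<in> A"
    "\<And>x y. x \<in> A \<Longrightarrow> y \<in> A \<Longrightarrow> \<phi> (x + y) = \<phi> x + \<phi> y"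
    "\<And>x y. x \<in> A \<Longrightarrow> y \<in> A \<Longrightarrow> \<phi> (x * y) = \<phi> x * \<phi> y"
    "\<And>c. \<phi> (\<iota> c) = c" "\<phi> \<zeta> = c0"
    "\<And>x. x \<in> A \<Longrightarrow> \<phi> x \<noteq> 0 \<Longrightarrow> inverse x \<in> A"
proof -
  interpret field_hom \<iota> by fact
  let ?ev = "evaluate \<iota> \<zeta>"
  interpret ev: comm_ring_hom ?ev by (rule comm_ring_hom_evaluate)
  have trans: "?ev g = 0 \<longleftrightarrow> g = 0" for g
    using sep by (auto simp: separating_variable_def evaluate_def)
  have R: "subring_set (range ?ev)"
    unfolding subring_set_def
    by (auto simp flip: ev.hom_minus ev.hom_mult) (metis ev.hom_one rangeI)
  have "?ev [:- c0, 1:] * r \<noteq> 1" if r: "r \<in> range ?ev" for r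
  proof
    obtain g where g: "r = ?ev g" using r by blast
    assume "?ev [:- c0, 1:] * r = 1"
    then have "?ev ([:- c0, 1:] * g - 1) = 0" by (simp only: g ev.hom_mult ev.hom_minus ev.hom_one) simp
    then have "[:- c0, 1:] * g = 1" by (simp only: trans) simp
    then have "poly ([:- c0, 1:] * g) c0 = 1" by (simp only:) simp
    then show False by simp
  qed
  then obtain A where A: "subring_set A" "range ?ev \<subseteq> A" "\<And>z. z \<in> A \<or> inverse z \<in> A"
    "\<And>r. r \<in> A \<Longrightarrow> ?ev [:- c0, 1:] * r \<noteq> 1"
    using valuation_ring_exists[OF R, of "?ev [:- c0, 1:]"] by blast
  have const: "\<iota> c \<in> A" for c using A(2) evaluate_const[of \<zeta> c] by (metis rangeI subsetD)
  have "?ev [:- c0, 1:] \<in> A" using A(2) by blast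
  then have "?ev [:- c0, 1:] + \<iota> c0 \<in> A" using const subring_set_add[OF A(1)] by blast
  then have \<zeta>: "\<zeta> \<in> A" by simp
  let ?m = "nonunits A"
  note m = nonunits_mult[OF A(1,3)] nonunits_add[OF A(1,3)] nonunits_sum[OF A(1,3)]
    nonunits_prime[OF A(1,3)] nonunits_diff[OF A(1,3)]
  have unif: "\<zeta> - \<iota> c0 \<in> ?m" using A(4) \<open>?ev [:- c0, 1:] \<in> A\<close> by (simp add: nonunits_def)
  have const_unit: "c = 0" if "\<iota> c \<in> ?m" for c
  proof (rule ccontr)
    assume "c \<noteq> 0"
    then have "\<iota> c * \<iota> (inverse c) = 1" by (simp add: hom_inverse)
    then show False using that const by (auto simp: nonunits_def)
  qed
  \<comment> \<open>The residue of h(\<zeta>) is \<open>poly h c0\<close>, because the difference is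
    divisible by \<open>\<zeta> - \<iota> c0\<close>.\<close>
  have value_at: "?ev h - \<iota> (poly h c0) \<in> ?m" for h
  proof -
    have "poly (h - [:poly h c0:]) c0 = 0" by simp
    then obtain h' where h': "h - [:poly h c0:] = [:- c0, 1:] * h'"
      by (metis dvdE poly_eq_0_iff_dvd)
    have "?ev h - \<iota> (poly h c0) = ?ev (h - [:poly h c0:])" by (simp add: ev.hom_minus)
    also have "\<dots> = (\<zeta> - \<iota> c0) * ?ev h'" unfolding h' by (simp only: ev.hom_mult evaluate_linear)
    finally show ?thesis using m(1)[OF unif] A(2) by auto
  qed
  \<comment> \<open>Over K the polynomial \<open>g\<close> splits into linear factors, and the
    maximal ideal is prime, so \<open>z\<close> is congruent to a root of \<open>g\<close>.\<close>
  have root: "\<exists>c. z - \<iota> c \<in> ?m"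
    if z: "z \<in> A" and g: "g \<noteq> 0" "poly (map_poly \<iota> g) z \<in> ?m" for z and g :: "'k poly"
    using g
  proof (induction "Polynomial.degree g" arbitrary: g)
    case 0
    then obtain c where "g = [:c:]" by (metis degree_eq_zeroE)
    then show ?case using 0 const_unit by (auto simp: map_poly_pCons_hom)
  next
    case (Suc n)
    then obtain c where "poly g c = 0" using alg_closed_imp_poly_has_root[of g] by auto
    then obtain g' where g': "g = [:- c, 1:] * g'" by (metis dvdE poly_eq_0_iff_dvd)
    have g'0: "g' \<noteq> 0" using Suc.prems g' by auto
    have "Polynomial.degree g = 1 + Polynomial.degree g'"
      unfolding g' using g'0 by (subst degree_mult_eq) auto
    then have n: "n = Polynomial.degree g'" using Suc.hyps(2) by simp
    have "poly (map_poly \<iota> g) z = (z - \<iota> c) * poly (map_poly \<iota> g') z"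
      unfolding g' map_poly_hom_mult by (simp add: map_poly_pCons_hom hom_uminus algebra_simps)
    moreover have "poly (map_poly \<iota> g') z \<in> A"
      using evaluate_mem[OF A(1) _ z, of g'] const by (auto simp: evaluate_def)
    moreover have "z - \<iota> c \<in> A" using z const subring_set_diff[OF A(1)] by blast
    ultimately have "z - \<iota> c \<in> ?m \<or> poly (map_poly \<iota> g') z \<in> ?m"
      using Suc.prems m(4) by metis
    then show ?case using Suc.hyps(1)[OF n g'0] by blast
  qed
  \<comment> \<open>An equation of \<open>z\<close> is needed that does not vanish identically at
    \<open>c0\<close>. The common factor \<open>[:- c0, 1:]\<close> of the coefficients is removed
    repeatedly; this ends because each removal lowers the degree of the leading coefficient.\<close>
  have primitive: "\<exists>G. map_poly (\<lambda>h. poly h c0) G \<noteq> 0 \<and> poly (map_poly ?ev G) z = 0"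
    if "G \<noteq> 0" "poly (map_poly ?ev G) z = 0" for z G
    using that
  proof (induction "Polynomial.degree (Polynomial.lead_coeff G)" arbitrary: G rule: less_induct)
    case less
    show ?case
    proof (cases "map_poly (\<lambda>h. poly h c0) G = 0")
      case False
      then show ?thesis using less.prems by blast
    next
      case True
      define G' where "G' = map_poly (\<lambda>h. h div [:- c0, 1:]) G"
      have "poly (poly.coeff G i) c0 = 0" for i
        using arg_cong[OF True, of "\<lambda>p. poly.coeff p i"] by (simp add: coeff_map_poly)
      then have "poly.coeff G i = [:- c0, 1:] * (poly.coeff G i div [:- c0, 1:])" for i
        by (metis dvd_mult_div_cancel poly_eq_0_iff_dvd)
      then have GG': "G = smult [:- c0, 1:] G'"
        by (intro poly_eqI) (auto simp: G'_def coeff_map_poly)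
      have G'0: "G' \<noteq> 0" using less.prems GG' by auto
      have "map_poly ?ev G = smult (?ev [:- c0, 1:]) (map_poly ?ev G')"
        by (subst GG', rule poly_eqI) (simp only: coeff_map_poly ev.hom_zero coeff_smult ev.hom_mult)
      moreover have "?ev [:- c0, 1:] \<noteq> 0" by (simp only: trans) simp
      ultimately have "poly (map_poly ?ev G') z = 0" using less.prems by simp
      moreover have "Polynomial.lead_coeff G = [:- c0, 1:] * Polynomial.lead_coeff G'"
        by (subst (1 2) GG') (rule lead_coeff_smult)
      then have "Polynomial.degree (Polynomial.lead_coeff G) = 1 + Polynomial.degree (Polynomial.lead_coeff G')"
        using G'0 by (simp only:) (subst degree_mult_eq, auto)
      ultimately show ?thesis using less.hyps[of G'] G'0 by auto
    qed
  qed
  have residue: "\<exists>c. z - \<iota> c \<in> ?m" if z: "z \<in> A" for z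
  proof -
    obtain G0 where G0: "poly (map_poly ?ev G0) z = 0" "poly (pderiv (map_poly ?ev G0)) z \<noteq> 0"
      by (rule separating_variable_polynomial[OF \<iota> sep])
    then have "G0 \<noteq> 0" by auto
    from primitive[OF this G0(1)]
    obtain G where G: "map_poly (\<lambda>h. poly h c0) G \<noteq> 0" "poly (map_poly ?ev G) z = 0"
      by blast
    define g where "g = map_poly (\<lambda>h. poly h c0) G"
    \<comment> \<open>The two polynomials are congruent coefficientwise, so \<open>z\<close> is a
      root of \<open>g\<close> modulo the maximal ideal.\<close>
    have "poly (map_poly ?ev G) z - poly (map_poly \<iota> g) z = poly (map_poly ?ev G - map_poly \<iota> g) z"
      by simp
    also have "\<dots> \<in> ?m"
      unfolding poly_altdef
    proof (intro m(3) m(1))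
      fix i
      show "poly.coeff (map_poly ?ev G - map_poly \<iota> g) i \<in> ?m"
        using value_at by (simp add: coeff_map_poly g_def)
      show "z ^ i \<in> A" using z by (rule subring_set_power[OF A(1)])
    qed
    finally have "0 - poly (map_poly \<iota> g) z \<in> ?m" using G(2) by simp
    from m(5)[OF nonunits_0[OF A(1,3)] this] have "poly (map_poly \<iota> g) z \<in> ?m" by simp
    then show ?thesis using root[OF z] G(1) by (auto simp: g_def)
  qed
  define \<phi> where "\<phi> z = (SOME c. z - \<iota> c \<in> ?m)" for z
  have \<phi>: "z - \<iota> (\<phi> z) \<in> ?m" if "z \<in> A" for z
    using residue[OF that] unfolding \<phi>_def by (rule someI_ex)
  have unique: "\<phi> z = c" if "z - \<iota> c \<in> ?m" and z: "z \<in> A" for z c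
  proof -
    have "(z - \<iota> (\<phi> z)) - (z - \<iota> c) \<in> ?m" by (intro m(5) \<phi> that)
    then have "\<iota> (c - \<phi> z) \<in> ?m" by (simp add: hom_minus)
    then show ?thesis using const_unit by fastforce
  qed
  show ?thesis
  proof
    show "subring_set A" "\<And>z. z \<in> A \<or> inverse z \<in> A" "\<zeta> \<in> A"
      using A \<zeta> by simp_all
    show "range \<iota> \<subseteq> A" using const by blast
    show "\<phi> \<zeta> = c0" by (rule unique[OF unif \<zeta>])
    show "\<phi> (\<iota> c) = c" for c using unique nonunits_0[OF A(1,3)] const by simp
    fix x y assume xy: "x \<in> A" "y \<in> A"
    have "(x - \<iota> (\<phi> x)) + (y - \<iota> (\<phi> y)) \<in> ?m" by (intro m(2) \<phi> xy)
    then show "\<phi> (x + y) = \<phi> x + \<phi> y"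
      using xy by (intro unique) (simp_all add: hom_add algebra_simps subring_set_add[OF A(1)])
    have "(x - \<iota> (\<phi> x)) * y + (y - \<iota> (\<phi> y)) * \<iota> (\<phi> x) \<in> ?m"
      by (intro m(2) m(1) \<phi> xy const)
    then show "\<phi> (x * y) = \<phi> x * \<phi> y"
      using xy by (intro unique) (simp_all add: hom_mult algebra_simps subring_set_mult[OF A(1)])
  next
    fix x assume x: "x \<in> A" "\<phi> x \<noteq> 0"
    have "x \<notin> ?m" using unique[of x 0] x by auto
    moreover from this have "x \<noteq> 0" using nonunits_0[OF A(1,3)] by auto
    ultimately show "inverse x \<in> A"
      using inverse_mem_iff_nonunit[OF A(1,3) x(1)] by simp
  qed
qed

section \<open>Hasse derivatives\<close>

locale hasse_family = field_hom \<iota> for \<iota> :: "'k::field \<Rightarrow> 'f::field" +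
  fixes \<zeta> :: 'f and D :: "nat \<Rightarrow> 'f \<Rightarrow> 'f"
  assumes hasse: "hasse_derivatives \<iota> \<zeta> D"
begin

lemma D_0 [simp]: "D 0 f = f"
  using hasse unfolding hasse_derivatives_def by simp

lemma D_add: "D i (f + g) = D i f + D i g"
  using hasse unfolding hasse_derivatives_def by simp

lemma D_scale: "D i (\<iota> c * f) = \<iota> c * D i f"
  using hasse unfolding hasse_derivatives_def by blast

lemma D_mult: "D i (f * g) = (\<Sum>j\<le>i. D j f * D (i - j) g)"
  using hasse unfolding hasse_derivatives_def by blast

lemma D_power: "D i (\<zeta> ^ n) = of_nat (n choose i) * \<zeta> ^ (n - i)"
  using hasse unfolding hasse_derivatives_def by blast

lemma D_zero [simp]: "D i 0 = 0"
  using D_scale[of i 0 0] by simp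

lemma D_const: "D i (\<iota> c) = (if i = 0 then \<iota> c else 0)"
  using D_scale[of i c 1] D_power[of i 0] by (cases i) auto

lemma D_uminus: "D i (- f) = - D i f"
  using D_add[of i f "- f"] by (simp add: eq_neg_iff_add_eq_0 add.commute)

lemma D_sum: "D i (\<Sum>j\<in>I. f j) = (\<Sum>j\<in>I. D i (f j))"
  by (induction I rule: infinite_finite_induct) (auto simp: D_add)

lemma D_var: "D i \<zeta> = (if i = 0 then \<zeta> else if i = 1 then 1 else 0)"
proof -
  have "Suc 0 choose i = 0" if "i > 1" using that by (simp add: binomial_eq_0)
  then show ?thesis using D_power[of i 1] by (cases "i > 1") (auto simp: not_less le_Suc_eq binomial_eq_0)
qed

section \<open>Integrality of Hasse derivatives over a subring\<close>

context
  fixes A :: "'f set"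
  assumes A: "subring_set A"
begin

lemma D_poly_mem:
  assumes z: "\<And>l. l \<le> m \<Longrightarrow> D l z \<in> A" and P: "\<And>i l. D l (poly.coeff P i) \<in> A" and "k \<le> m"
  shows "D k (poly P z) \<in> A"
  using P \<open>k \<le> m\<close>
proof (induction P arbitrary: k)
  case 0
  then show ?case by (simp add: subring_set_0[OF A])
next
  case (pCons a P)
  have "D l (poly.coeff P i) \<in> A" for i l using pCons.prems(1)[of l "Suc i"] by simp
  moreover have "D k a \<in> A" using pCons.prems(1)[of k 0] by simp
  ultimately show ?case using pCons.IH pCons.prems(2) z
    by (auto simp: D_add D_mult intro!: subring_set_closed[OF A])
qed

text \<open>By the product rule \<open>D k z\<close> enters linearly, with factor
  \<open>poly (pderiv P) z\<close>. All other terms involve derivatives of the coefficients and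
  derivatives of \<open>z\<close> of order below \<open>k\<close>.\<close>

lemma D_poly_linear_part:
  assumes z: "\<And>l. l < k \<Longrightarrow> D l z \<in> A" and k: "k > 0" and P: "\<And>i l. D l (poly.coeff P i) \<in> A"
  shows "D k (poly P z) - poly (pderiv P) z * D k z \<in> A"
  using P
proof (induction P)
  case 0
  then show ?case by (simp add: subring_set_0[OF A])
next
  case (pCons a P)
  define Q where "Q = poly P z"
  have P: "D l (poly.coeff P i) \<in> A" for i l using pCons.prems[of l "Suc i"] by simp
  have a: "D k a \<in> A" using pCons.prems[of k 0] by simp
  have Q: "D l Q \<in> A" if "l < k" for l
    unfolding Q_def using that z P by (intro D_poly_mem[of "k - 1"]) auto
  have "D k (z * Q) = (\<Sum>j\<in>insert 0 (insert k {0<..<k}). D j z * D (k - j) Q)"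
    unfolding D_mult using k by (intro sum.cong) auto
  also have "\<dots> = z * D k Q + D k z * Q + (\<Sum>j\<in>{0<..<k}. D j z * D (k - j) Q)"
    using k by simp
  finally have "D k (poly (pCons a P) z) - poly (pderiv (pCons a P)) z * D k z
      = D k a + z * (D k Q - poly (pderiv P) z * D k z) + (\<Sum>j\<in>{0<..<k}. D j z * D (k - j) Q)"
    by (simp add: D_add pderiv_pCons Q_def algebra_simps)
  also have "\<dots> \<in> A"
  proof (intro subring_set_add[OF A] subring_set_sum[OF A])
    show "z * (D k Q - poly (pderiv P) z * D k z) \<in> A"
      using z[of 0] k by (intro subring_set_mult[OF A] pCons.IH[OF P, folded Q_def]) simp
    show "D j z * D (k - j) Q \<in> A" if "j \<in> {0<..<k}" for j
      using that by (intro subring_set_mult[OF A] z Q) auto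
  qed (rule a)
  finally show ?case .
qed

lemma D_evaluate_mem:
  assumes "range \<iota> \<subseteq> A" "\<zeta> \<in> A"
  shows "D k (evaluate \<iota> \<zeta> g) \<in> A"
  unfolding evaluate_def
  by (rule D_poly_mem[of k])
    (use assms in \<open>auto simp: D_var D_const coeff_map_poly subring_set_closed[OF A]\<close>)

text \<open>Implicit differentiation: applying \<open>D k\<close> to the equation of
  \<open>z\<close> puts \<open>D k z\<close>, times the value of the derivative polynomial at
  \<open>z\<close>, into \<open>A\<close>, and that value has its inverse in
  \<open>A\<close>.\<close>

lemma D_root_mem:
  assumes \<iota>: "range \<iota> \<subseteq> A" and \<zeta>: "\<zeta> \<in> A" and z: "z \<in> A"
    and root: "poly (map_poly (evaluate \<iota> \<zeta>) G) z = 0"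
    and simple: "poly (pderiv (map_poly (evaluate \<iota> \<zeta>) G)) z \<noteq> 0"
      "inverse (poly (pderiv (map_poly (evaluate \<iota> \<zeta>) G)) z) \<in> A"
  shows "D k z \<in> A"
proof (induction k rule: less_induct)
  case (less k)
  interpret ev: comm_ring_hom "evaluate \<iota> \<zeta>" by (rule comm_ring_hom_evaluate)
  let ?P = "map_poly (evaluate \<iota> \<zeta>) G"
  show ?case
  proof (cases "k = 0")
    case False
    have "D k (poly ?P z) - poly (pderiv ?P) z * D k z \<in> A"
      by (rule D_poly_linear_part) (use less False D_evaluate_mem[OF \<iota> \<zeta>] in \<open>auto simp: coeff_map_poly\<close>)
    then have "poly (pderiv ?P) z * D k z \<in> A"
      using root subring_set_uminus[OF A] by fastforce
    then have "inverse (poly (pderiv ?P) z) * (poly (pderiv ?P) z * D k z) \<in> A"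
      using simple subring_set_mult[OF A] by blast
    then show ?thesis using simple by (simp add: mult.assoc[symmetric])
  qed (use z in simp)
qed

end

end

section \<open>Taylor expansion at a general place\<close>

lemma separating_variable_nonzero:
  assumes "separating_variable \<iota> \<zeta>"
  shows "evaluate \<iota> \<zeta> g = 0 \<longleftrightarrow> g = 0"
  using assms by (auto simp: separating_variable_def evaluate_def)

text \<open>Here \<open>h\<close> is the leading coefficient of an equation of \<open>z\<close> over
  K[\<zeta>]. Where its value is invertible, \<open>z\<close> is integral over \<open>A\<close>, and
  a valuation ring is integrally closed. The points excluded are the zeros of
  \<open>h\<close>.\<close>

lemma integral_outside_finitely_many_places:
  fixes \<iota> :: "'k::field \<Rightarrow> 'f::field"
  assumes \<iota>: "field_hom \<iota>" and sep: "separating_variable \<iota> \<zeta>"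
  obtains h where "h \<noteq> 0" "\<And>A. subring_set A \<Longrightarrow> range \<iota> \<subseteq> A \<Longrightarrow> \<zeta> \<in> A \<Longrightarrow>
    (\<And>z. z \<in> A \<or> inverse z \<in> A) \<Longrightarrow> inverse (evaluate \<iota> \<zeta> h) \<in> A \<Longrightarrow> z \<in> A"
proof -
  interpret field_hom \<iota> by fact
  interpret ev: comm_ring_hom "evaluate \<iota> \<zeta>" by (rule comm_ring_hom_evaluate)
  obtain G where G: "poly (map_poly (evaluate \<iota> \<zeta>) G) z = 0"
    "poly (pderiv (map_poly (evaluate \<iota> \<zeta>) G)) z \<noteq> 0"
    by (rule separating_variable_polynomial[OF \<iota> sep])
  have "G \<noteq> 0" using G(2) by auto
  define h where "h = Polynomial.lead_coeff G"
  define P where "P = map_poly (evaluate \<iota> \<zeta>) G"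
  have h: "h \<noteq> 0" using \<open>G \<noteq> 0\<close> by (simp add: h_def)
  have evh: "evaluate \<iota> \<zeta> h \<noteq> 0" using h by (simp add: separating_variable_nonzero[OF sep])
  have "Polynomial.degree P = Polynomial.degree G"
    unfolding P_def by (rule degree_map_poly) (simp add: separating_variable_nonzero[OF sep])
  then have lead: "Polynomial.lead_coeff P = evaluate \<iota> \<zeta> h"
    by (simp add: P_def h_def coeff_map_poly)
  have "z \<in> A" if A: "subring_set A" "range \<iota> \<subseteq> A" "\<zeta> \<in> A" "\<And>z. z \<in> A \<or> inverse z \<in> A"
    "inverse (evaluate \<iota> \<zeta> h) \<in> A" for A
  proof (rule ccontr)
    assume "z \<notin> A"
    then have y: "inverse z \<in> A" "z \<noteq> 0" using A(4) subring_set_0[OF A(1)] by auto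
    obtain a Q where Q: "reflect_poly P = pCons a Q" by (cases "reflect_poly P")
    have a: "a = evaluate \<iota> \<zeta> h" using arg_cong[OF Q, of "\<lambda>p. poly.coeff p 0"] lead by simp
    have "poly (reflect_poly P) (inverse z) = 0"
      using y G(1) by (simp add: poly_reflect_poly_nz P_def)
    then have "a = - (inverse z * poly Q (inverse z))"
      unfolding Q by (simp add: eq_neg_iff_add_eq_0)
    \<comment> \<open>The equation divided by the highest power of \<open>z\<close> expresses
      \<open>z\<close> through \<open>inverse z\<close>, which lies in \<open>A\<close>.\<close>
    then have zQ: "z = - (poly Q (inverse z) * inverse a)"
      using y evh a by (simp add: field_simps)
    have "poly Q (inverse z) \<in> A"
    proof (rule subring_set_poly[OF A(1) _ y(1)])
      fix i
      have "poly.coeff Q i = poly.coeff (reflect_poly P) (Suc i)" by (simp add: Q)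
      also have "\<dots> \<in> A"
        using evaluate_mem[OF A(1-3)] subring_set_0[OF A(1)]
        by (auto simp: coeff_reflect_poly P_def coeff_map_poly)
      finally show "poly.coeff Q i \<in> A" .
    qed
    then have "- (poly Q (inverse z) * inverse a) \<in> A"
      using A(5) a by (intro subring_set_uminus[OF A(1)] subring_set_mult[OF A(1)]) simp_all
    then show False using \<open>z \<notin> A\<close> zQ by simp
  qed
  then show ?thesis using that[of h] h by blast
qed

text \<open>An element of least valuation divides the others. It serves to scale a linear relation
  so that it stays non-zero under reduction.\<close>

lemma common_divisor_in_valuation_ring:
  fixes A :: "'f::field set"
  assumes A: "subring_set A" and val: "\<And>z. z \<in> A \<or> inverse z \<in> A"
    and S: "finite S" "S \<noteq> {}" "0 \<notin> S"
  shows "\<exists>s\<in>S. \<forall>t\<in>S. t / s \<in> A"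
  using S
proof (induction rule: finite_ne_induct)
  case (singleton u)
  then show ?case by (simp add: subring_set_1[OF A])
next
  case (insert u S)
  then obtain s where s: "s \<in> S" "\<forall>t\<in>S. t / s \<in> A" by auto
  show ?case
  proof (cases "u / s \<in> A")
    case True
    then show ?thesis using s by blast
  next
    case False
    then have *: "s / u \<in> A" using val[of "u / s"] by simp
    have "t / u \<in> A" if "t \<in> S" for t
    proof -
      have "t / s * (s / u) \<in> A" using s(2) that * subring_set_mult[OF A] by blast
      moreover have "s \<noteq> 0" using s insert.prems by auto
      ultimately show ?thesis by simp
    qed
    then show ?thesis using insert.prems by (auto simp: subring_set_1[OF A])
  qed
qed

text \<open>A root of \<open>h - 1\<close> is a point where \<open>h\<close> has the value 1; only
  constant \<open>h\<close> is treated separately.\<close>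

lemma alg_closed_nonroot:
  fixes h :: "'k::alg_closed_field poly"
  assumes "h \<noteq> 0"
  obtains c where "poly h c \<noteq> 0"
proof (cases "Polynomial.degree (h - 1) = 0")
  case True
  then have "Polynomial.degree h = 0"
    by (metis degree_1 degree_add_le diff_add_cancel le_zero_eq order_refl)
  then obtain a where "h = [:a:]" by (metis degree_eq_zeroE)
  then show ?thesis using that assms by auto
next
  case False
  then obtain c where "poly (h - 1) c = 0" using alg_closed_imp_poly_has_root by blast
  then show ?thesis using that[of c] by auto
qed

text \<open>
  A relation \<open>w\<close> among all rows is reduced at a place \<open>\<phi>\<close>. The Taylor expansion at this place,
  \<open>z \<mapsto> \<Sum> \<phi> (D k z) t\<^sup>k\<close>, is an injective \<open>K\<close>-algebra homomorphism, so the reduced relation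
  is a \<open>K\<close>-linear relation among the \<open>x j\<close>.
\<close>

lemma hasse_rows_span:
  fixes \<iota> :: "'k::alg_closed_field \<Rightarrow> 'f::field" and n :: nat
  assumes fam: "hasse_family \<iota> \<zeta> D" and sep: "separating_variable \<iota> \<zeta>"
    and indep: "\<And>c. (\<Sum>j<n. \<iota> (c j) * x j) = 0 \<Longrightarrow> \<forall>j<n. c j = 0"
    and w: "\<And>k. (\<Sum>j<n. w j * D k (x j)) = 0"
  shows "\<forall>j<n. w j = 0"
proof (rule ccontr)
  interpret hasse_family \<iota> \<zeta> D by fact
  interpret ev: comm_ring_hom "evaluate \<iota> \<zeta>" by (rule comm_ring_hom_evaluate)
  note hom = field_hom_axioms
  assume neg: "\<not> (\<forall>j<n. w j = 0)"
  let ?P = "\<lambda>G. map_poly (evaluate \<iota> \<zeta>) G"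
  have "\<exists>G. poly (?P G) z = 0 \<and> poly (pderiv (?P G)) z \<noteq> 0" for z
    using separating_variable_polynomial[OF hom sep, of z] by blast
  then obtain G where G: "\<And>z. poly (?P (G z)) z = 0" "\<And>z. poly (pderiv (?P (G z))) z \<noteq> 0"
    by metis
  \<comment> \<open>\<open>D_root_mem\<close> requires this inverse to be integral too, so
    \<open>\<delta> (x j)\<close> has to be controlled along with \<open>x j\<close>.\<close>
  define \<delta> where "\<delta> z = inverse (poly (pderiv (?P (G z))) z)" for z
  have "\<exists>h. h \<noteq> 0 \<and> (\<forall>A. subring_set A \<longrightarrow> range \<iota> \<subseteq> A \<longrightarrow> \<zeta> \<in> A \<longrightarrow>
    (\<forall>z. z \<in> A \<or> inverse z \<in> A) \<longrightarrow> inverse (evaluate \<iota> \<zeta> h) \<in> A \<longrightarrow> z \<in> A)" for z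
    by (rule integral_outside_finitely_many_places[OF hom sep, of z]) blast
  then obtain h where h: "\<And>z. h z \<noteq> 0"
    "\<And>z A. subring_set A \<Longrightarrow> range \<iota> \<subseteq> A \<Longrightarrow> \<zeta> \<in> A \<Longrightarrow>
    (\<And>z. z \<in> A \<or> inverse z \<in> A) \<Longrightarrow> inverse (evaluate \<iota> \<zeta> (h z)) \<in> A \<Longrightarrow> z \<in> A"
    by metis
  \<comment> \<open>Only finitely many points of the line are excluded, so \<open>c0\<close> can
    avoid them. At a place above it all \<open>x j\<close> and \<open>\<delta> (x j)\<close> are
    integral, and then so are all \<open>D k (x j)\<close>.\<close>
  obtain c0 where "poly (\<Prod>j<n. h (x j) * h (\<delta> (x j))) c0 \<noteq> 0"
    using alg_closed_nonroot[of "\<Prod>j<n. h (x j) * h (\<delta> (x j))"] h(1) by auto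
  then have c0: "poly (h (x j)) c0 \<noteq> 0" "poly (h (\<delta> (x j))) c0 \<noteq> 0" if "j < n" for j
    using that by (auto simp: poly_prod)
  obtain A \<phi> where A: "subring_set A" "range \<iota> \<subseteq> A" "\<zeta> \<in> A" "\<And>z. z \<in> A \<or> inverse z \<in> A"
    and \<phi>: "\<And>x y. x \<in> A \<Longrightarrow> y \<in> A \<Longrightarrow> \<phi> (x + y) = \<phi> x + \<phi> y"
      "\<And>x y. x \<in> A \<Longrightarrow> y \<in> A \<Longrightarrow> \<phi> (x * y) = \<phi> x * \<phi> y"
      "\<And>c. \<phi> (\<iota> c) = c" "\<phi> \<zeta> = c0"
      "\<And>x. x \<in> A \<Longrightarrow> \<phi> x \<noteq> 0 \<Longrightarrow> inverse x \<in> A"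
    using place_exists[OF hom sep, of c0] by blast
  note closed = subring_set_closed[OF A(1)]
  have \<phi>0: "\<phi> 0 = 0" and \<phi>1: "\<phi> 1 = 1" using \<phi>(3)[of 0] \<phi>(3)[of 1] by simp_all
  have \<phi>_sum: "\<phi> (\<Sum>i\<in>I. f i) = (\<Sum>i\<in>I. \<phi> (f i))" if f: "\<And>i. i \<in> I \<Longrightarrow> f i \<in> A"
    for I :: "nat set" and f
    using f
  proof (induction I rule: infinite_finite_induct)
    case (insert i I)
    then show ?case by (simp add: \<phi>(1) closed)
  qed (simp_all add: \<phi>0)
  have \<iota>A: "\<iota> c \<in> A" for c using A(2) by blast
  have evA: "evaluate \<iota> \<zeta> g \<in> A" for g by (rule evaluate_mem[OF A(1-3)])
  have DevA: "D k (evaluate \<iota> \<zeta> g) \<in> A" for k g by (rule D_evaluate_mem[OF A(1-3)])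
  have ev_pCons: "evaluate \<iota> \<zeta> (pCons a g) = \<iota> a + \<zeta> * evaluate \<iota> \<zeta> g" for a g
    by (simp add: evaluate_def map_poly_pCons_hom)
  have \<phi>_ev: "\<phi> (evaluate \<iota> \<zeta> g) = poly g c0" for g
  proof (induction g)
    case (pCons a g)
    then show ?case by (simp add: ev_pCons \<phi> \<iota>A A evA closed)
  qed (simp add: \<phi>0)
  have integral: "z \<in> A" if "poly (h z) c0 \<noteq> 0" for z
    by (rule h(2)[OF A \<phi>(5)[OF evA]]) (simp add: \<phi>_ev that)
  have xA: "x j \<in> A" "\<delta> (x j) \<in> A" if "j < n" for j
    using c0[OF that] by (simp_all add: integral)
  have DxA: "D k (x j) \<in> A" if "j < n" for k j
    using D_root_mem[OF A(1-3) xA(1)[OF that] G] xA(2)[OF that] by (simp add: \<delta>_def)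
  \<comment> \<open>The Taylor series at the place. On K[\<zeta>] it is the substitution of c0 + t
    for \<zeta>, hence injective there.\<close>
  define S where "S z = Abs_fps (\<lambda>k. \<phi> (D k z))" for z
  have S_ev: "S (evaluate \<iota> \<zeta> g) = fps_of_poly (g \<circ>\<^sub>p [:c0, 1:])" for g
  proof (induction g)
    case 0
    then show ?case by (simp add: S_def \<phi>0 fps_eq_iff)
  next
    case (pCons a g)
    have "fps_nth (S (evaluate \<iota> \<zeta> (pCons a g))) k =
        fps_nth (fps_const a + fps_of_poly [:c0, 1:] * S (evaluate \<iota> \<zeta> g)) k" for k
    proof -
      have "D k (evaluate \<iota> \<zeta> (pCons a g)) = D k (\<iota> a) + (\<Sum>j\<le>k. D j \<zeta> * D (k - j) (evaluate \<iota> \<zeta> g))"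
        by (simp add: ev_pCons D_add D_mult)
      moreover have DA: "D j (\<iota> a) \<in> A" "D j \<zeta> \<in> A" for j
        using A(3) \<iota>A closed(1,2) by (auto simp: D_const D_var)
      ultimately have "\<phi> (D k (evaluate \<iota> \<zeta> (pCons a g))) =
          \<phi> (D k (\<iota> a)) + (\<Sum>j\<le>k. \<phi> (D j \<zeta>) * \<phi> (D (k - j) (evaluate \<iota> \<zeta> g)))"
        by (simp add: \<phi>(1,2) \<phi>_sum DevA closed)
      also have "(\<Sum>j\<le>k. \<phi> (D j \<zeta>) * \<phi> (D (k - j) (evaluate \<iota> \<zeta> g))) =
          (\<Sum>j\<le>k. poly.coeff [:c0, 1:] j * \<phi> (D (k - j) (evaluate \<iota> \<zeta> g)))"
        by (intro sum.cong) (auto simp: D_var \<phi> \<phi>0 \<phi>1 coeff_pCons split: nat.split)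
      finally show ?thesis
        by (simp add: S_def fps_mult_nth atMost_atLeast0 D_const \<phi> \<phi>0)
    qed
    then have "S (evaluate \<iota> \<zeta> (pCons a g)) =
        fps_const a + fps_of_poly [:c0, 1:] * S (evaluate \<iota> \<zeta> g)"
      by (simp add: fps_eq_iff)
    then show ?case
      by (simp add: pCons.IH pcompose_pCons fps_of_poly_add fps_of_poly_mult fps_of_poly_const)
  qed
  \<comment> \<open>Injectivity is carried over from K[\<zeta>]. After division by a power of
    \<open>y\<close>, the equation of \<open>y\<close> has a constant term
    \<open>a \<noteq> 0\<close>, so \<open>evaluate \<iota> \<zeta> a = - (y * u)\<close>. If the
    expansion of \<open>y\<close> vanished, that of a(\<zeta>) would vanish too.\<close>
  have S_inj: "y = 0" if y: "\<And>k. D k y \<in> A" "\<And>k. \<phi> (D k y) = 0" for y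
  proof (rule ccontr)
    assume "y \<noteq> 0"
    have nonzero_const: "\<exists>a g. a \<noteq> 0 \<and> poly (?P (pCons a g)) y = 0"
      if "g \<noteq> 0" "poly (?P g) y = 0" for g
      using that
    proof (induction g)
      case (pCons a g)
      then show ?case using \<open>y \<noteq> 0\<close>
        by (cases "a = 0") (auto simp: ev.map_poly_pCons_hom)
    qed simp
    have "G y \<noteq> 0" using G(2)[of y] by auto
    from nonzero_const[OF this G(1)]
    obtain a g where a: "a \<noteq> 0" "poly (?P (pCons a g)) y = 0"
      by blast
    define u where "u = poly (?P g) y"
    have u: "D k u \<in> A" for k
      unfolding u_def by (rule D_poly_mem[OF A(1), of k]) (auto simp: y coeff_map_poly DevA)
    have "evaluate \<iota> \<zeta> a = - (y * u)"
      using a(2) by (simp add: ev.map_poly_pCons_hom u_def eq_neg_iff_add_eq_0)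
    moreover have "\<phi> (D k (- (y * u))) = 0" for k
    proof -
      have "\<phi> (D k (y * u)) = (\<Sum>j\<le>k. \<phi> (D j y) * \<phi> (D (k - j) u))"
        using y u by (simp add: D_mult \<phi>(2) \<phi>_sum closed)
      then have "\<phi> (D k (y * u)) = 0" by (simp add: y)
      moreover have "\<phi> (D k (- (y * u)) + D k (y * u)) = \<phi> (D k (- (y * u))) + \<phi> (D k (y * u))"
        by (intro \<phi>(1)) (auto simp: D_uminus D_mult intro!: closed y u)
      ultimately show ?thesis by (simp add: D_uminus \<phi>0)
    qed
    ultimately have "S (evaluate \<iota> \<zeta> a) = 0" by (simp add: S_def fps_eq_iff)
    then show False using a(1) by (simp add: S_ev pcompose_eq_0_iff)
  qed
  \<comment> \<open>After division by an entry \<open>s\<close> of least valuation, the relation has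
    all entries in \<open>A\<close> and one of them equal to 1, so its reduction \<open>v\<close> is
    non-zero.\<close>
  have "\<exists>s\<in>w ` {..<n} - {0}. \<forall>t\<in>w ` {..<n} - {0}. t / s \<in> A"
    by (rule common_divisor_in_valuation_ring[OF A(1,4)]) (use neg in auto)
  then obtain s where s: "s \<in> w ` {..<n} - {0}" "\<forall>t\<in>w ` {..<n} - {0}. t / s \<in> A"
    by blast
  then obtain i where i: "i < n" "w i = s" "s \<noteq> 0" by auto
  define v where "v j = \<phi> (w j / s)" for j
  have wA: "w j / s \<in> A" if "j < n" for j
    using s(2) that closed(1) by (cases "w j = 0") auto
  define y where "y = (\<Sum>j<n. \<iota> (v j) * x j)"
  have Dy: "D k y = (\<Sum>j<n. \<iota> (v j) * D k (x j))" for k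
    by (simp add: y_def D_sum D_scale)
  have "D k y \<in> A" for k unfolding Dy by (intro closed) (auto intro: \<iota>A DxA)
  moreover have "\<phi> (D k y) = 0" for k
  proof -
    have "\<phi> (D k y) = (\<Sum>j<n. \<phi> (\<iota> (v j) * D k (x j)))"
      unfolding Dy by (rule \<phi>_sum) (auto intro: closed(4) \<iota>A DxA)
    also have "\<dots> = (\<Sum>j<n. \<phi> (w j / s * D k (x j)))"
    proof (intro sum.cong refl)
      fix j assume "j \<in> {..<n}"
      then have "w j / s \<in> A" "D k (x j) \<in> A" using wA DxA by auto
      then show "\<phi> (\<iota> (v j) * D k (x j)) = \<phi> (w j / s * D k (x j))"
        by (simp only: \<phi>(2,3) \<iota>A v_def)
    qed
    also have "\<dots> = \<phi> (\<Sum>j<n. w j / s * D k (x j))"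
      by (rule \<phi>_sum[symmetric]) (auto intro!: closed(4) wA DxA simp del: times_divide_eq_left)
    also have "(\<Sum>j<n. w j / s * D k (x j)) = (\<Sum>j<n. w j * D k (x j)) / s"
      by (simp add: sum_divide_distrib)
    finally show ?thesis using w \<phi>0 by simp
  qed
  ultimately have "y = 0" by (rule S_inj)
  then have "v i = 0" using indep i(1) by (simp add: y_def)
  then show False using i by (simp add: v_def \<phi>1)
qed

text \<open>The Taylor map \<open>T\<close> into power series is multiplicative, and in
  characteristic p the p-th power of f + t g is f^p + t^p g^p. No term of degree 1, ..., p - 1
  occurs in it.\<close>

lemma (in hasse_family) D_power_char:
  assumes p: "prime p" "CHAR('f) = p" and "k < p"
  shows "D k (f ^ p) = (if k = 0 then f ^ p else 0)"
proof -
  define T where "T g = Abs_fps (\<lambda>k. D k g)" for g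
  have T_mult: "T (g * h) = T g * T h" for g h
    by (simp add: T_def fps_eq_iff fps_mult_nth D_mult atMost_atLeast0)
  have T_power: "T (f ^ Suc n) = T f ^ Suc n" for n
    by (induction n) (simp_all add: T_mult)
  have "T f = fps_const f + fps_X * Abs_fps (\<lambda>k. D (Suc k) f)"
    by (simp add: T_def fps_eq_iff fps_X_mult_nth)
  then have "T f ^ p = fps_const f ^ p + (fps_X * Abs_fps (\<lambda>k. D (Suc k) f)) ^ p"
    using freshmans_dream[where 'a = "'f fps"] p by simp
  also have "\<dots> = fps_const (f ^ p) + fps_X ^ p * Abs_fps (\<lambda>k. D (Suc k) f) ^ p"
    by (simp add: power_mult_distrib fps_const_power)
  finally have "fps_nth (T f ^ p) k = (if k = 0 then f ^ p else 0)"
    using \<open>k < p\<close> by (simp add: fps_X_power_mult_nth)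
  moreover have "T (f ^ p) = T f ^ p"
    using T_power[of "p - 1"] prime_gt_0_nat[OF p(1)] by simp
  ultimately show ?thesis by (metis T_def fps_nth_Abs_fps)
qed

section \<open>Existence of the Frobenius order-sequence\<close>

lemma det_eq_0_iff_rows_dependent:
  fixes M :: "'a::field mat"
  assumes M: "M \<in> carrier_mat n n"
  shows "det M = 0 \<longleftrightarrow> (\<exists>c. (\<exists>i<n. c i \<noteq> 0) \<and> (\<forall>j<n. (\<Sum>i<n. c i * M $$ (i, j)) = 0))"
proof -
  have "det M = 0 \<longleftrightarrow> (\<exists>v. v \<in> carrier_vec n \<and> v \<noteq> 0\<^sub>v n \<and> transpose_mat M *\<^sub>v v = 0\<^sub>v n)"
    using det_0_iff_vec_prod_zero[of "transpose_mat M" n] M det_transpose[OF M] by simp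
  also have "\<dots> \<longleftrightarrow> (\<exists>c. (\<exists>i<n. c i \<noteq> 0) \<and> (\<forall>j<n. (\<Sum>i<n. c i * M $$ (i, j)) = 0))"
  proof safe
    fix v assume v: "v \<in> carrier_vec n" "v \<noteq> 0\<^sub>v n" "transpose_mat M *\<^sub>v v = 0\<^sub>v n"
    have "\<exists>i<n. v $ i \<noteq> 0" using v(1,2) by (auto simp: vec_eq_iff)
    moreover have "(\<Sum>i<n. v $ i * M $$ (i, j)) = 0" if "j < n" for j
      using arg_cong[OF v(3), of "\<lambda>u. vec_index u j"] that v(1) M
      by (simp add: scalar_prod_def lessThan_atLeast0 mult.commute)
    ultimately show "\<exists>c. (\<exists>i<n. c i \<noteq> 0) \<and> (\<forall>j<n. (\<Sum>i<n. c i * M $$ (i, j)) = 0)" by blast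
  next
    fix c i assume c: "\<forall>j<n. (\<Sum>i<n. c i * M $$ (i, j)) = 0" "i < n" "c i \<noteq> 0"
    have "Matrix.vec n c \<noteq> 0\<^sub>v n" using c by (auto simp: vec_eq_iff)
    moreover have "transpose_mat M *\<^sub>v Matrix.vec n c = 0\<^sub>v n"
      using c(1) M by (intro eq_vecI) (auto simp: scalar_prod_def lessThan_atLeast0 mult.commute)
    ultimately show "\<exists>v. v \<in> carrier_vec n \<and> v \<noteq> 0\<^sub>v n \<and> transpose_mat M *\<^sub>v v = 0\<^sub>v n"
      by (intro exI[of _ "Matrix.vec n c"]) auto
  qed
  finally show ?thesis .
qed

lemma det_eq_0_iff_columns_dependent:
  fixes M :: "'a::field mat"
  assumes M: "M \<in> carrier_mat n n"
  shows "det M = 0 \<longleftrightarrow> (\<exists>c. (\<exists>j<n. c j \<noteq> 0) \<and> (\<forall>i<n. (\<Sum>j<n. c j * M $$ (i, j)) = 0))"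
proof -
  have "(\<Sum>i<n. c i * transpose_mat M $$ (i, j)) = (\<Sum>i<n. c i * M $$ (j, i))" if "j < n" for c j
    using that M by (intro sum.cong) auto
  then show ?thesis
    using det_eq_0_iff_rows_dependent[of "transpose_mat M" n] M det_transpose[OF M] by simp
qed

lemma underdetermined_system:
  fixes f :: "nat \<Rightarrow> nat \<Rightarrow> 'a::field"
  assumes "m < n"
  shows "\<exists>c. (\<exists>j<n. c j \<noteq> 0) \<and> (\<forall>i<m. (\<Sum>j<n. c j * f i j) = 0)"
proof -
  \<comment> \<open>Zero rows pad the system to a square one. Row \<open>m\<close> is zero, so the
    rows are dependent and the determinant vanishes.\<close>
  define M where "M = mat n n (\<lambda>(i, j). if i < m then f i j else 0)"
  have M: "M \<in> carrier_mat n n" by (simp add: M_def)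
  have "det M = 0"
    unfolding det_eq_0_iff_rows_dependent[OF M]
    using assms by (intro exI[of _ "\<lambda>i. if i = m then 1 else 0"]) (auto simp: M_def intro!: sum.neutral)
  then obtain c where "\<exists>j<n. c j \<noteq> 0" and c: "\<forall>i<n. (\<Sum>j<n. c j * M $$ (i, j)) = 0"
    unfolding det_eq_0_iff_columns_dependent[OF M] by blast
  moreover have "(\<Sum>j<n. c j * f i j) = 0" if "i < m" for i
    using c[rule_format, of i] that assms by (simp add: M_def)
  ultimately show ?thesis by blast
qed

text \<open>Spanning is stated dually: only the zero functional \<open>w\<close> annihilates every
  \<open>v k\<close>. While at most \<open>r\<close> vectors are chosen, some non-zero
  \<open>w\<close> annihilates them all; a \<open>v k\<close> that it does not annihilate is
  independent of them and has a new index.\<close>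

lemma steinitz_extension:
  fixes x0 :: "nat \<Rightarrow> 'a::field" and v :: "nat \<Rightarrow> nat \<Rightarrow> 'a"
  assumes x0: "\<exists>j\<le>r. x0 j \<noteq> 0"
    and span: "\<And>w. (\<And>k. (\<Sum>j\<le>r. w j * v k j) = 0) \<Longrightarrow> \<forall>j\<le>r. w j = 0"
    and "m \<le> r"
  shows "\<exists>N. finite N \<and> card N = m \<and>
    (\<forall>a c. (\<forall>j\<le>r. a * x0 j + (\<Sum>k\<in>N. c k * v k j) = 0) \<longrightarrow> a = 0 \<and> (\<forall>k\<in>N. c k = 0))"
  using \<open>m \<le> r\<close>
proof (induction m)
  case 0
  then show ?case using x0 by (intro exI[of _ "{}"]) auto
next
  case (Suc m)
  then have "m \<le> r" by simp
  from Suc.IH[OF this] obtain N where N: "finite N" "card N = m"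
    and indep: "\<forall>a c. (\<forall>j\<le>r. a * x0 j + (\<Sum>k\<in>N. c k * v k j) = 0) \<longrightarrow> a = 0 \<and> (\<forall>k\<in>N. c k = 0)"
    by (elim exE conjE)
  obtain e where e: "bij_betw e {..<m} N"
    using ex_bij_betw_nat_finite[OF N(1)] N(2) by (auto simp: lessThan_atLeast0)
  have "Suc m < Suc r" using Suc.prems by simp
  from underdetermined_system[OF this, of "\<lambda>i j. case i of 0 \<Rightarrow> x0 j | Suc i \<Rightarrow> v (e i) j"]
  obtain w where w: "\<exists>j\<le>r. w j \<noteq> 0"
    and w0: "\<And>i. i < Suc m \<Longrightarrow> (\<Sum>j\<le>r. w j * (case i of 0 \<Rightarrow> x0 j | Suc i \<Rightarrow> v (e i) j)) = 0"
    by (auto simp: lessThan_Suc_atMost less_Suc_eq_le)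
  have wx: "(\<Sum>j\<le>r. w j * x0 j) = 0" using w0[of 0] by simp
  have wv: "(\<Sum>j\<le>r. w j * v k j) = 0" if k: "k \<in> N" for k
  proof -
    obtain i where "i < m" "k = e i" using k e by (auto simp: bij_betw_def)
    then show ?thesis using w0[of "Suc i"] by simp
  qed
  obtain k where k: "(\<Sum>j\<le>r. w j * v k j) \<noteq> 0" using span w by blast
  have kN: "k \<notin> N" using k wv by blast
  have ext: "a = 0 \<and> (\<forall>k\<in>insert k N. c k = 0)"
    if rel: "\<And>j. j \<le> r \<Longrightarrow> a * x0 j + (\<Sum>k\<in>insert k N. c k * v k j) = 0" for a c
  proof -
    \<comment> \<open>Applying \<open>w\<close> to the relation kills \<open>x0\<close> and all old
      rows and isolates the coefficient of the new one.\<close>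
    have "0 = (\<Sum>j\<le>r. w j * (a * x0 j + (\<Sum>k\<in>insert k N. c k * v k j)))"
      by (simp add: rel)
    also have "\<dots> = a * (\<Sum>j\<le>r. w j * x0 j) + (\<Sum>k\<in>insert k N. c k * (\<Sum>j\<le>r. w j * v k j))"
      by (simp only: distrib_left sum.distrib sum_distrib_left sum.swap[of _ "insert k N"] mult.left_commute)
    also have "\<dots> = c k * (\<Sum>j\<le>r. w j * v k j)"
      using kN N(1) by (simp add: wx wv)
    finally have ck: "c k = 0" using k by simp
    have "a * x0 j + (\<Sum>k\<in>N. c k * v k j) = 0" if "j \<le> r" for j
      using rel[OF that] kN N(1) ck by simp
    then have "a = 0 \<and> (\<forall>k\<in>N. c k = 0)" using indep by blast
    then show ?thesis using ck by blast
  qed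
  have card: "finite (insert k N)" "card (insert k N) = Suc m" using N kN by simp_all
  show ?case
  proof (intro exI[of _ "insert k N"] conjI card)
    show "\<forall>a c. (\<forall>j\<le>r. a * x0 j + (\<Sum>k\<in>insert k N. c k * v k j) = 0) \<longrightarrow>
        a = 0 \<and> (\<forall>k\<in>insert k N. c k = 0)"
      by (intro allI impI ext) simp
  qed
qed

text \<open>The row of q-th powers is non-zero, so it is completed to a basis by derivative rows of
  distinct orders; these orders, sorted, are the entries of \<open>\<nu>\<close>.\<close>

lemma frobenius_admissible_exists:
  fixes x :: "'f::field vec"
  assumes x0: "\<exists>j\<le>r. x $ j \<noteq> 0"
    and span: "\<And>w. (\<And>k. (\<Sum>j\<le>r. w j * D k (x $ j)) = 0) \<Longrightarrow> \<forall>j\<le>r. w j = 0"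
  shows "\<exists>\<nu>. frobenius_admissible q r D x \<nu>"
proof -
  have "\<exists>j\<le>r. (x $ j) ^ q \<noteq> 0" using x0 by auto
  from this span order_refl have "\<exists>N. finite N \<and> card N = r \<and>
    (\<forall>a c. (\<forall>j\<le>r. a * (x $ j) ^ q + (\<Sum>k\<in>N. c k * D k (x $ j)) = 0) \<longrightarrow>
      a = 0 \<and> (\<forall>k\<in>N. c k = 0))"
    by (rule steinitz_extension)
  then obtain N where N: "finite N" "card N = r"
    and indep: "\<forall>a c. (\<forall>j\<le>r. a * (x $ j) ^ q + (\<Sum>k\<in>N. c k * D k (x $ j)) = 0) \<longrightarrow>
      a = 0 \<and> (\<forall>k\<in>N. c k = 0)"
    by (elim exE conjE)
  define \<nu> where "\<nu> = sorted_list_of_set N"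
  have len: "length \<nu> = r" using N by (simp add: \<nu>_def)
  have bij: "bij_betw ((!) \<nu>) {..<r} N"
    using N(1) len by (intro bij_betw_nth) (simp_all add: \<nu>_def)
  let ?M = "frobenius_matrix q r D x \<nu>"
  have M: "?M \<in> carrier_mat (Suc r) (Suc r)" by (simp add: frobenius_matrix_def)
  have "det ?M \<noteq> 0"
  proof
    assume "det ?M = 0"
    then obtain c where c: "\<exists>i\<le>r. c i \<noteq> 0" "\<And>j. j \<le> r \<Longrightarrow> (\<Sum>i<Suc r. c i * ?M $$ (i, j)) = 0"
      unfolding det_eq_0_iff_rows_dependent[OF M] by (auto simp: less_Suc_eq_le)
    \<comment> \<open>Coefficients are moved from positions in \<open>\<nu>\<close> to elements of
      \<open>N\<close>. The \<open>Suc\<close> skips the row of powers, which has index 0.\<close>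
    define d where "d k = c (Suc (inv_into {..<r} ((!) \<nu>) k))" for k
    have d: "d (\<nu> ! i) = c (Suc i)" if "i < r" for i
      using bij that by (simp add: d_def bij_betw_def inv_into_f_f)
    have "c 0 * (x $ j) ^ q + (\<Sum>k\<in>N. d k * D k (x $ j)) = 0" if j: "j \<le> r" for j
    proof -
      have "(\<Sum>k\<in>N. d k * D k (x $ j)) = (\<Sum>i<r. c (Suc i) * D (\<nu> ! i) (x $ j))"
        by (subst sum.reindex_bij_betw[OF bij, symmetric]) (auto intro!: sum.cong simp: d)
      moreover have "(\<Sum>i<Suc r. c i * ?M $$ (i, j)) =
          c 0 * (x $ j) ^ q + (\<Sum>i<r. c (Suc i) * D (\<nu> ! i) (x $ j))"
        unfolding sum.lessThan_Suc_shift using j by (simp add: frobenius_matrix_def)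
      ultimately show ?thesis using c(2)[OF j] by simp
    qed
    then have "c 0 = 0" "\<forall>k\<in>N. d k = 0" using indep by blast+
    moreover from this have "c (Suc i) = 0" if "i < r" for i
      using d[OF that] bij that by (auto simp: bij_betw_def)
    ultimately have "c i = 0" if "i \<le> r" for i using that by (cases i) auto
    then show False using c(1) by blast
  qed
  then have "frobenius_admissible q r D x \<nu>"
    using len by (simp add: frobenius_admissible_def \<nu>_def)
  then show ?thesis by blast
qed

text \<open>Admissible sequences all have length \<open>r\<close>. On lists of equal length
  \<open>lexord\<close> agrees with \<open>lex\<close>, which is well-founded, and linearity makes a
  minimal element the least one.\<close>

lemma frobenius_order_sequence_exists:
  assumes "frobenius_admissible q r D x \<mu>"
  shows "\<exists>\<nu>. frobenius_order_sequence q r D x \<nu>"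
proof -
  let ?less = "{(a, b). a < (b::nat)}"
  have "wf (lex ?less)" by (intro wf_lex wf)
  then obtain \<nu> where \<nu>: "frobenius_admissible q r D x \<nu>"
    and min: "\<And>\<mu>. (\<mu>, \<nu>) \<in> lex ?less \<Longrightarrow> \<not> frobenius_admissible q r D x \<mu>"
    using assms wf_eq_minimal[of "lex ?less"] by (metis mem_Collect_eq)
  have "\<nu> = \<mu> \<or> (\<nu>, \<mu>) \<in> lexord ?less" if "frobenius_admissible q r D x \<mu>" for \<mu>
  proof -
    have "(\<mu>, \<nu>) \<notin> lexord ?less"
      using min[of \<mu>] that \<nu> by (auto simp: lexord_lex frobenius_admissible_def)
    moreover have "(\<nu>, \<mu>) \<in> lexord ?less \<or> \<nu> = \<mu> \<or> (\<mu>, \<nu>) \<in> lexord ?less"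
      by (rule lexord_linear) auto
    ultimately show ?thesis by blast
  qed
  then show ?thesis using \<nu> by (auto simp: frobenius_order_sequence_def)
qed

lemma frobenius_nonclassicalI:
  assumes "\<exists>\<mu>. frobenius_admissible q r D x \<mu>"
    and "det (frobenius_matrix q r D x [0..<r]) = 0"
  shows "frobenius_nonclassical q r D x"
proof -
  obtain \<nu> where \<nu>: "frobenius_order_sequence q r D x \<nu>"
    using frobenius_order_sequence_exists assms(1) by blast
  then have "length \<nu> = r" "\<nu> \<noteq> [0..<r]"
    using assms(2) by (auto simp: frobenius_order_sequence_def frobenius_admissible_def)
  then have "\<exists>i<r. \<nu> ! i \<noteq> i" by (auto simp: list_eq_iff_nth_eq)
  then show ?thesis using \<nu> by (auto simp: frobenius_nonclassical_def)
qed

section \<open>Forms and the function field\<close>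

definition monomial_value :: "(nat \<Rightarrow>\<^sub>0 nat) \<Rightarrow> 'b::comm_ring_1 vec \<Rightarrow> 'b" where
  "monomial_value m v = (\<Prod>j\<in>Poly_Mapping.keys m. v $ j ^ Poly_Mapping.lookup m j)"

lemma mpoly_eval_superset:
  assumes "\<iota> 0 = 0" "finite S" "Poly_Mapping.keys f \<subseteq> S"
  shows "mpoly_eval \<iota> v f = (\<Sum>m\<in>S. \<iota> (Poly_Mapping.lookup f m) * monomial_value m v)"
  unfolding mpoly_eval_def monomial_value_def
  using assms by (intro sum.mono_neutral_left) (auto simp: in_keys_iff)

lemma mpoly_eval_0 [simp]: "mpoly_eval \<iota> v 0 = 0"
  by (simp add: mpoly_eval_def)

lemma mpoly_eval_add:
  assumes "comm_ring_hom \<iota>"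
  shows "mpoly_eval \<iota> v (f + g) = mpoly_eval \<iota> v f + mpoly_eval \<iota> v g"
proof -
  interpret comm_ring_hom \<iota> by fact
  let ?S = "Poly_Mapping.keys f \<union> Poly_Mapping.keys g"
  have "Poly_Mapping.keys (f + g) \<subseteq> ?S" by (rule Poly_Mapping.keys_add)
  then show ?thesis
    using mpoly_eval_superset[of \<iota> ?S f v] mpoly_eval_superset[of \<iota> ?S g v]
      mpoly_eval_superset[of \<iota> ?S "f + g" v]
    by (simp add: lookup_add hom_add distrib_right sum.distrib)
qed

lemma mpoly_eval_single:
  assumes "\<iota> 0 = 0"
  shows "mpoly_eval \<iota> v (Poly_Mapping.single m c) =
    \<iota> c * monomial_value m v"
  using mpoly_eval_superset[of \<iota> "{m}" "Poly_Mapping.single m c" v] assms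
  by (auto split: if_splits)

lemma homogeneous_add:
  assumes "homogeneous n d f" "homogeneous n d g"
  shows "homogeneous n d (f + g)"
  using assms Poly_Mapping.keys_add[of f g] by (fastforce simp: homogeneous_def)

lemma monomial_value_times_variable:
  "monomial_value (m + Poly_Mapping.single j 1) v = v $ j * monomial_value m v" (is "?l = _")
proof -
  let ?S = "insert j (Poly_Mapping.keys m)"
  have "?l = (\<Prod>i\<in>?S. v $ i ^ Poly_Mapping.lookup (m + Poly_Mapping.single j 1) i)"
    using Poly_Mapping.keys_add[of m "Poly_Mapping.single j 1"]
    unfolding monomial_value_def by (intro prod.mono_neutral_left) (auto simp: in_keys_iff)
  also have "\<dots> = (\<Prod>i\<in>?S. v $ i ^ Poly_Mapping.lookup m i) * (\<Prod>i\<in>?S. v $ i ^ (if i = j then 1 else 0))"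
    by (subst prod.distrib[symmetric], intro prod.cong)
      (auto simp: lookup_add lookup_single power_add when_def)
  also have "(\<Prod>i\<in>?S. v $ i ^ (if i = j then 1 else 0)) = (\<Prod>i\<in>{j}. v $ i)"
    by (intro prod.mono_neutral_cong_right) auto
  also have "(\<Prod>i\<in>?S. v $ i ^ Poly_Mapping.lookup m i) = monomial_value m v"
    unfolding monomial_value_def by (intro prod.mono_neutral_right) (auto simp: in_keys_iff)
  finally show ?thesis by (simp add: mult.commute)
qed

lemma degree_times_variable:
  "(\<Sum>i\<in>Poly_Mapping.keys (m + Poly_Mapping.single j 1). Poly_Mapping.lookup (m + Poly_Mapping.single j 1) i) =
    Suc (\<Sum>i\<in>Poly_Mapping.keys m. Poly_Mapping.lookup m i)" (is "?l = _")
proof -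
  let ?S = "insert j (Poly_Mapping.keys m)"
  have "?l = (\<Sum>i\<in>?S. Poly_Mapping.lookup (m + Poly_Mapping.single j 1) i)"
    using Poly_Mapping.keys_add[of m "Poly_Mapping.single j 1"]
    by (intro sum.mono_neutral_left) (auto simp: in_keys_iff)
  also have "\<dots> = (\<Sum>i\<in>?S. Poly_Mapping.lookup m i) + (\<Sum>i\<in>?S. if i = j then 1 else 0)"
    by (subst sum.distrib[symmetric], intro sum.cong) (auto simp: lookup_add lookup_single when_def)
  also have "(\<Sum>i\<in>?S. if i = j then 1 else 0) = (1::nat)"
    by simp
  also have "(\<Sum>i\<in>?S. Poly_Mapping.lookup m i) = (\<Sum>i\<in>Poly_Mapping.keys m. Poly_Mapping.lookup m i)"
    by (intro sum.mono_neutral_right) (auto simp: in_keys_iff)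
  finally show ?thesis by simp
qed

text \<open>A form is only seen through its values: \<open>\<psi>\<close> at the points over \<open>K\<close>, and \<open>e\<close> at \<open>x\<close>.\<close>

definition form_values ::
    "nat \<Rightarrow> nat \<Rightarrow> ('k::field \<Rightarrow> 'f::field) \<Rightarrow> 'f vec \<Rightarrow> ('k vec \<Rightarrow> 'k) \<Rightarrow> 'f \<Rightarrow> bool" where
  "form_values n d \<iota> x \<psi> e \<longleftrightarrow>
     (\<exists>f. homogeneous n d f \<and> (\<forall>P. mpoly_eval id P f = \<psi> P) \<and> mpoly_eval \<iota> x f = e)"

context field_hom
begin

lemma comm_ring_hom_id: "comm_ring_hom (id :: 'c::comm_ring_1 \<Rightarrow> 'c)"
  by standard auto

lemma form_values_0: "form_values n d hom x (\<lambda>_. 0) 0"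
  unfolding form_values_def by (intro exI[of _ 0]) (simp add: homogeneous_def)

lemma form_values_1: "form_values n 0 hom x (\<lambda>_. 1) 1"
  unfolding form_values_def
  by (intro exI[of _ "Poly_Mapping.single 0 1"])
    (simp add: homogeneous_def mpoly_eval_single monomial_value_def del: single_one)

lemma form_values_add:
  assumes "form_values n d hom x \<psi> e" "form_values n d hom x \<psi>' e'"
  shows "form_values n d hom x (\<lambda>P. \<psi> P + \<psi>' P) (e + e')"
proof -
  obtain f g where "homogeneous n d f" "\<forall>P. mpoly_eval id P f = \<psi> P" "mpoly_eval hom x f = e"
    "homogeneous n d g" "\<forall>P. mpoly_eval id P g = \<psi>' P" "mpoly_eval hom x g = e'"
    using assms unfolding form_values_def by blast
  then show ?thesis
    unfolding form_values_def
    by (intro exI[of _ "f + g"])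
      (simp add: homogeneous_add mpoly_eval_add[OF comm_ring_hom_id] mpoly_eval_add[OF comm_ring_hom_axioms])
qed

lemma form_values_sum:
  assumes "\<And>i. i \<in> I \<Longrightarrow> form_values n d hom x (\<psi> i) (e i)"
  shows "form_values n d hom x (\<lambda>P. \<Sum>i\<in>I. \<psi> i P) (\<Sum>i\<in>I. e i)"
  using assms
  by (induction I rule: infinite_finite_induct) (auto intro: form_values_0 form_values_add)

text \<open>Powers of linear forms are built by multiplying with one scaled variable at a time, so
  products of two general forms never have to be formed.\<close>

lemma form_values_times_variable:
  assumes "form_values n d hom x \<psi> e" and j: "j < n"
  shows "form_values n (Suc d) hom x (\<lambda>P. c * P $ j * \<psi> P) (hom c * x $ j * e)"
proof -
  obtain f where f: "homogeneous n d f" "\<And>P. mpoly_eval id P f = \<psi> P" "mpoly_eval hom x f = e"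
    using assms unfolding form_values_def by blast
  have "form_values n (Suc d) hom x
    (\<lambda>P. \<Sum>m\<in>Poly_Mapping.keys f. c * Poly_Mapping.lookup f m * (P $ j * monomial_value m P))
    (\<Sum>m\<in>Poly_Mapping.keys f. hom (c * Poly_Mapping.lookup f m) * (x $ j * monomial_value m x))"
  proof (rule form_values_sum)
    fix m assume m: "m \<in> Poly_Mapping.keys f"
    let ?m = "m + Poly_Mapping.single j 1"
    have "Poly_Mapping.keys ?m \<subseteq> {..<n}"
      using Poly_Mapping.keys_add[of m "Poly_Mapping.single j 1"] f(1) m j
      by (force simp: homogeneous_def)
    moreover have "(\<Sum>i\<in>Poly_Mapping.keys ?m. Poly_Mapping.lookup ?m i) = Suc d"
      unfolding degree_times_variable using f(1) m by (simp add: homogeneous_def)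
    ultimately have "homogeneous n (Suc d) (Poly_Mapping.single ?m (c * Poly_Mapping.lookup f m))"
      unfolding homogeneous_def by (auto split: if_splits)
    then show "form_values n (Suc d) hom x
        (\<lambda>P. c * Poly_Mapping.lookup f m * (P $ j * monomial_value m P))
        (hom (c * Poly_Mapping.lookup f m) * (x $ j * monomial_value m x))"
      unfolding form_values_def
      by (intro exI[of _ "Poly_Mapping.single ?m (c * Poly_Mapping.lookup f m)"])
        (simp only: mpoly_eval_single hom_zero id_apply monomial_value_times_variable simp_thms)
  qed
  moreover have "(\<lambda>P. \<Sum>m\<in>Poly_Mapping.keys f. c * Poly_Mapping.lookup f m * (P $ j * monomial_value m P)) =
      (\<lambda>P. c * P $ j * \<psi> P)"
    by (simp add: f(2)[symmetric] mpoly_eval_def monomial_value_def sum_distrib_left ac_simps)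
  moreover have "(\<Sum>m\<in>Poly_Mapping.keys f. hom (c * Poly_Mapping.lookup f m) * (x $ j * monomial_value m x)) =
      hom c * x $ j * e"
    by (simp add: f(3)[symmetric] mpoly_eval_def monomial_value_def sum_distrib_left hom_mult ac_simps)
  ultimately show ?thesis by simp
qed

text \<open>The case of degree 1 covers linear relations among the coordinates. Sums over several
  \<open>b\<close> give the power sums of the curve, written in the coordinates of PG(p - 3,
  K).\<close>

lemma form_values_linear_power:
  "form_values n d hom x (\<lambda>P. (\<Sum>j<n. b j * P $ j) ^ d) ((\<Sum>j<n. hom (b j) * x $ j) ^ d)"
proof (induction d)
  case 0
  then show ?case using form_values_1 by simp
next
  case (Suc d)
  have "form_values n (Suc d) hom x
    (\<lambda>P. \<Sum>j<n. b j * P $ j * (\<Sum>j<n. b j * P $ j) ^ d)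
    (\<Sum>j<n. hom (b j) * x $ j * (\<Sum>j<n. hom (b j) * x $ j) ^ d)"
    by (intro form_values_sum form_values_times_variable[OF Suc]) auto
  then show ?case by (simp add: sum_distrib_right)
qed

end

lemma function_field_of_form:
  assumes ff: "function_field_of r \<Gamma> \<iota> x" and form: "form_values (r + 1) d \<iota> x \<psi> e"
  shows "e = 0 \<longleftrightarrow> (\<forall>P\<in>\<Gamma>. \<psi> P = 0)"
proof -
  obtain f where f: "homogeneous (r + 1) d f" "\<And>P. mpoly_eval id P f = \<psi> P" "mpoly_eval \<iota> x f = e"
    using form unfolding form_values_def by blast
  have "mpoly_eval \<iota> x f = 0 \<longleftrightarrow> (\<forall>P\<in>\<Gamma>. mpoly_eval id P f = 0)"
    using ff f(1) unfolding function_field_of_def by blast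
  then show ?thesis using f by simp
qed

section \<open>The power sum curve\<close>

text \<open>A form of Newton's identities. The derivative of \<open>P\<close> is the sum of the
  quotients \<open>q i\<close> of \<open>P\<close> by the linear factors, and division by such a
  factor yields the coefficients of \<open>q i\<close> from the top downwards. Together these force
  the coefficients of \<open>P\<close> in degrees 2, ..., n - 1 to vanish.\<close>

lemma trinomial_of_power_sums:
  fixes y :: "nat \<Rightarrow> 'f::field"
  assumes n: "n \<ge> 2" and char: "\<And>k. 0 < k \<Longrightarrow> k < n \<Longrightarrow> of_nat k \<noteq> (0 :: 'f)"
    and s: "\<And>k. 1 \<le> k \<Longrightarrow> k \<le> n - 2 \<Longrightarrow> (\<Sum>i<n. y i ^ k) = 0"
  shows "\<exists>a b. \<forall>i<n. y i ^ n + a * y i + b = 0"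
proof -
  define P where "P = (\<Prod>i<n. [:- y i, 1:])"
  define q where "q i = (\<Prod>j\<in>{..<n} - {i}. [:- y j, 1:])" for i
  have Pq: "P = [:- y i, 1:] * q i" if "i < n" for i
    unfolding P_def q_def using that by (intro prod.remove) auto
  have c0: "poly.coeff P 0 = - y i * poly.coeff (q i) 0" if "i < n" for i
    using Pq[OF that] by simp
  have cSuc: "poly.coeff P (Suc m) = - y i * poly.coeff (q i) (Suc m) + poly.coeff (q i) m"
    if "i < n" for i m
    using Pq[OF that] by simp
  have der: "of_nat (Suc m) * poly.coeff P (Suc m) = (\<Sum>i<n. poly.coeff (q i) m)" for m
  proof -
    have "pderiv P = (\<Sum>i<n. q i)"
      unfolding P_def q_def by (simp add: pderiv_prod pderiv_pCons)
    from arg_cong[OF this, of "\<lambda>f. poly.coeff f m"] show ?thesis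
      by (simp add: coeff_sum coeff_pderiv del: of_nat_Suc)
  qed
  have degq: "Polynomial.degree (q i) = n - 1" if "i < n" for i
    unfolding q_def using that by (subst degree_prod_eq_sum_degree) auto
  have lcq: "poly.coeff (q i) (n - 1) = 1" if "i < n" for i
  proof -
    have "Polynomial.lead_coeff (q i) = 1" unfolding q_def by (simp add: lead_coeff_prod)
    then show ?thesis using degq[OF that] by simp
  qed
  have qd: "\<forall>i<n. poly.coeff (q i) (n - 1 - d) = y i ^ d" if "d \<le> n - 2" for d
    using that
  proof (induction d)
    case 0
    then show ?case using lcq by simp
  next
    case (Suc d)
    define m where "m = n - 1 - Suc d"
    have m: "Suc m = n - 1 - d" "n = Suc m + Suc d" using Suc.prems n by (auto simp: m_def)
    have qm: "poly.coeff (q i) m = poly.coeff P (Suc m) + y i ^ Suc d" if "i < n" for i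
    proof -
      have "poly.coeff (q i) (Suc m) = y i ^ d"
        unfolding m(1) using Suc.IH Suc.prems that by simp
      then show ?thesis using cSuc[OF that, of m] by simp
    qed
    \<comment> \<open>As the power sum vanishes, the coefficient of \<open>P\<close> in degree
      \<open>Suc m\<close> has the same multiples by \<open>Suc m\<close> and by
      \<open>n = Suc m + Suc d\<close>. Hence \<open>Suc d\<close> times it is zero, and
      \<open>Suc d < n\<close> is invertible.\<close>
    have "of_nat (Suc m) * poly.coeff P (Suc m) = (\<Sum>i<n. poly.coeff P (Suc m) + y i ^ Suc d)"
      unfolding der using qm by simp
    also have "\<dots> = of_nat n * poly.coeff P (Suc m)"
      using s[of "Suc d"] Suc.prems by (simp add: sum.distrib)
    also have "of_nat n = (of_nat (Suc m) + of_nat (Suc d) :: 'f)"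
      by (subst m(2)) (rule of_nat_add)
    finally have "of_nat (Suc d) * poly.coeff P (Suc m) = 0" by (simp only: distrib_right) simp
    moreover have "of_nat (Suc d) \<noteq> (0 :: 'f)" using Suc.prems n by (intro char) auto
    ultimately have "poly.coeff P (Suc m) = 0" by (simp only: mult_eq_0_iff) blast
    then show ?case using qm by (simp add: m_def)
  qed
  have "y i ^ n + poly.coeff P 1 * y i + poly.coeff P 0 = 0" if "i < n" for i
  proof -
    have "n - 1 - (n - 2) = Suc 0" using n by simp
    then have q1: "poly.coeff (q i) (Suc 0) = y i ^ (n - 2)" using qd[of "n - 2"] that by simp
    have yn: "y i ^ n = y i ^ (n - 2) * y i * y i"
      using n by (metis le_add_diff_inverse2 mult.assoc power2_eq_square power_add)
    have q0: "poly.coeff (q i) 0 = poly.coeff P 1 + y i * y i ^ (n - 2)"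
      using cSuc[OF that, of 0] q1 by simp
    show ?thesis by (simp only: c0[OF that] q0 yn) (simp add: algebra_simps)
  qed
  then show ?thesis by blast
qed

text \<open>Multiplication by \<open>g\<close> permutes the non-zero elements and multiplies the sum
  by \<open>g ^ k\<close>. Some \<open>g\<close> has \<open>g ^ k \<noteq> 1\<close>, because T^k -
  1 has at most k roots, fewer than there are non-zero elements.\<close>

lemma sum_powers_nonzero_eq_0:
  fixes k :: nat
  assumes k: "0 < k" "k < card (UNIV :: 'a::finite_field set) - 1"
  shows "(\<Sum>u\<in>UNIV - {0}. u ^ k) = (0 :: 'a)"
proof -
  have "\<exists>g::'a. g \<noteq> 0 \<and> g ^ k \<noteq> 1"
  proof (rule ccontr)
    assume "\<not> ?thesis"
    then have "UNIV - {0} \<subseteq> {u::'a. poly (Polynomial.monom 1 k - 1) u = 0}"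
      by (auto simp: poly_monom)
    moreover have nz: "Polynomial.monom 1 k - 1 \<noteq> (0 :: 'a poly)"
      using k(1) by (metis degree_1 degree_monom_eq eq_iff_diff_eq_0 nat_less_le zero_neq_one)
    ultimately have "card (UNIV - {0} :: 'a set) \<le> card {u::'a. poly (Polynomial.monom 1 k - 1) u = 0}"
      by (intro card_mono poly_roots_finite)
    also have "\<dots> \<le> Polynomial.degree (Polynomial.monom 1 k - 1 :: 'a poly)"
      by (rule card_poly_roots_bound[OF nz])
    also have "\<dots> \<le> k" by (rule degree_diff_le) (auto simp: degree_monom_le)
    finally show False using k(2) by simp
  qed
  then obtain g :: 'a where g: "g \<noteq> 0" "g ^ k \<noteq> 1" by blast
  have "bij_betw (\<lambda>u. g * u) (UNIV - {0}) (UNIV - {0})"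
    by (rule bij_betw_byWitness[where f' = "\<lambda>u. u / g"]) (use g in auto)
  from sum.reindex_bij_betw[OF this, of "\<lambda>u. u ^ k"]
  have "(\<Sum>u\<in>UNIV - {0}. (g * u) ^ k) = (\<Sum>u\<in>UNIV - {0}. u ^ k)" .
  moreover have "(\<Sum>u\<in>UNIV - {0}. (g * u) ^ k) = g ^ k * (\<Sum>u\<in>UNIV - {0}. u ^ k)"
    by (simp add: power_mult_distrib sum_distrib_left)
  ultimately have "(g ^ k - 1) * (\<Sum>u\<in>UNIV - {0}. u ^ k) = 0"
    by (simp add: left_diff_distrib)
  then show ?thesis using g(2) by simp
qed

lemma bij_nonzero_in_power_sum_curve:
  fixes e :: "nat \<Rightarrow> 'p::prime_card mod_ring"
  assumes p: "p = CARD('p)" "p \<ge> 3" and e: "bij_betw e {..<p - 1} (UNIV - {0})"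
  shows "Matrix.vec (p - 1) (\<lambda>i. to_ac (e i)) \<in> power_sum_curve p"
proof -
  have "(\<Sum>i<p - 1. to_ac (e i) ^ k) = 0" if "k \<in> {1..p - 3}" for k
  proof -
    have "(\<Sum>i<p - 1. e i ^ k) = (\<Sum>u\<in>UNIV - {0}. u ^ k)"
      by (rule sum.reindex_bij_betw[OF e])
    also have "\<dots> = 0" using that p by (intro sum_powers_nonzero_eq_0) auto
    finally have "to_ac (\<Sum>i<p - 1. e i ^ k) = 0" by simp
    then show ?thesis by (simp add: to_ac_sum)
  qed
  moreover have "e 0 \<noteq> 0" using e p by (auto simp: bij_betw_def)
  then have "Matrix.vec (p - 1) (\<lambda>i. to_ac (e i)) \<noteq> 0\<^sub>v (p - 1)"
    using p by (auto simp: vec_eq_iff intro!: exI[of _ 0])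
  ultimately show ?thesis by (simp add: power_sum_curve_def)
qed

text \<open>An enumeration \<open>e\<close> of the non-zero elements of the prime field gives a
  point of the curve, and so does \<open>e\<close> with its values at \<open>i\<close> and
  \<open>j\<close> exchanged. Subtracting the two conditions leaves
  \<open>(l i - l j) * (to_ac (e i) - to_ac (e j)) = 0\<close>. Thus the curve spans the
  hyperplane.\<close>

lemma linear_form_vanishing_on_power_sum_curve:
  fixes l :: "nat \<Rightarrow> 'p::prime_card mod_ring alg_closure"
  assumes p: "p = CARD('p)" "p \<ge> 3"
    and van: "\<And>Q. Q \<in> power_sum_curve p \<Longrightarrow> (\<Sum>i<p - 1. l i * Q $ i) = 0"
    and ij: "i < p - 1" "j < p - 1"
  shows "l i = l j"
proof (cases "i = j")
  case False
  have "card (UNIV - {0} :: 'p mod_ring set) = p - 1" using p by simp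
  then obtain e :: "nat \<Rightarrow> 'p mod_ring" where e: "bij_betw e {..<p - 1} (UNIV - {0})"
    using ex_bij_betw_nat_finite[of "UNIV - {0} :: 'p mod_ring set"] by (auto simp: lessThan_atLeast0)
  define \<tau> where "\<tau> = Transposition.transpose i j"
  have "bij_betw \<tau> {..<p - 1} {..<p - 1}"
    unfolding \<tau>_def using ij by (intro bij_betw_byWitness[where f' = "Transposition.transpose i j"])
      (auto simp: Transposition.transpose_def)
  then have e\<tau>: "bij_betw (e \<circ> \<tau>) {..<p - 1} (UNIV - {0})" using e by (rule bij_betw_trans)
  have "0 = (\<Sum>k<p - 1. l k * to_ac (e k)) - (\<Sum>k<p - 1. l k * to_ac (e (\<tau> k)))"
    using van[OF bij_nonzero_in_power_sum_curve[OF p e]] van[OF bij_nonzero_in_power_sum_curve[OF p e\<tau>]]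
    by simp
  also have "\<dots> = (\<Sum>k<p - 1. l k * (to_ac (e k) - to_ac (e (\<tau> k))))"
    by (simp add: sum_subtractf right_diff_distrib)
  also have "\<dots> = (\<Sum>k\<in>{i, j}. l k * (to_ac (e k) - to_ac (e (\<tau> k))))"
    using ij by (intro sum.mono_neutral_right) (auto simp: \<tau>_def Transposition.transpose_def)
  also have "\<dots> = (l i - l j) * (to_ac (e i) - to_ac (e j))"
    using False by (simp add: \<tau>_def algebra_simps)
  finally have "(l i - l j) * (to_ac (e i) - to_ac (e j)) = 0" by simp
  moreover have "e i \<noteq> e j" using e ij False by (auto simp: bij_betw_def inj_on_def)
  ultimately show ?thesis by simp
qed simp

lemma CHAR_field_hom:
  fixes \<iota> :: "'k::field \<Rightarrow> 'f::field"
  assumes "field_hom \<iota>"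
  shows "CHAR('f) = CHAR('k)"
proof (rule CHAR_eqI)
  interpret field_hom \<iota> by fact
  have *: "of_nat n = (0 :: 'f) \<longleftrightarrow> of_nat n = (0 :: 'k)" for n
    by (metis hom_0_iff hom_of_nat)
  show "of_nat CHAR('k) = (0 :: 'f)" by (simp add: *)
  show "CHAR('k) dvd n" if "of_nat n = (0 :: 'f)" for n
    using that by (simp add: * of_nat_eq_0_iff_char_dvd)
qed

lemma sum_mult_delta:
  fixes f :: "nat \<Rightarrow> 'a::semiring_1"
  assumes "k < n"
  shows "(\<Sum>j<n. f j * (if j = k then 1 else 0)) = f k"
    and "(\<Sum>j<n. (if j = k then 1 else 0) * f j) = f k"
proof -
  have "(\<Sum>j<n. f j * (if j = k then 1 else 0)) = (\<Sum>j<n. if j = k then f j else 0)"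
    "(\<Sum>j<n. (if j = k then 1 else 0) * f j) = (\<Sum>j<n. if j = k then f j else 0)"
    by (rule sum.cong; simp)+
  then show "(\<Sum>j<n. f j * (if j = k then 1 else 0)) = f k"
    "(\<Sum>j<n. (if j = k then 1 else 0) * f j) = f k"
    using assms by simp_all
qed

lemma sum_mult_delta_diff:
  fixes f :: "nat \<Rightarrow> 'a::ring_1"
  assumes "k < n" "l < n"
  shows "(\<Sum>j<n. f j * ((if j = k then 1 else 0) - (if j = l then 1 else 0))) = f k - f l"
  by (simp only: right_diff_distrib sum_subtractf sum_mult_delta(1)[OF assms(1)]
      sum_mult_delta(1)[OF assms(2)])

text \<open>Each \<open>y i\<close> satisfies a common trinomial equation; multiplied by
  \<open>y i ^ 2\<close> and summed, it leaves power sums of exponents 2 and 3, which are at most p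
  - 3.\<close>

lemma higher_power_sum_eq_0:
  fixes y :: "nat \<Rightarrow> 'f::field"
  assumes p: "p \<ge> 7" "CHAR('f) = p"
    and s: "\<And>k. 1 \<le> k \<Longrightarrow> k \<le> p - 3 \<Longrightarrow> (\<Sum>i<p - 1. y i ^ k) = 0"
  shows "(\<Sum>i<p - 1. y i ^ (p + 1)) = 0"
proof -
  note One_nat_def [simp del]
  have "of_nat k \<noteq> (0 :: 'f)" if "0 < k" "k < p - 1" for k
    using that p(2) by (auto simp: of_nat_eq_0_iff_char_dvd dest: dvd_imp_le)
  then obtain a b where ab: "\<And>i. i < p - 1 \<Longrightarrow> y i ^ (p - 1) + a * y i + b = 0"
    using trinomial_of_power_sums[of "p - 1" y] p(1) s by fastforce
  have "y i ^ (p + 1) = y i ^ 2 * y i ^ (p - 1)" for i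
  proof -
    have "p + 1 = 2 + (p - 1)" using p(1) by simp
    then show ?thesis by (metis power_add)
  qed
  then have *: "y i ^ 2 * (y i ^ (p - 1) + a * y i + b) = y i ^ (p + 1) + a * y i ^ 3 + b * y i ^ 2" for i
    by (simp only:) (simp add: algebra_simps power2_eq_square power3_eq_cube)
  have "0 = (\<Sum>i<p - 1. y i ^ 2 * (y i ^ (p - 1) + a * y i + b))"
    by (simp add: ab)
  also have "\<dots> = (\<Sum>i<p - 1. y i ^ (p + 1)) + a * (\<Sum>i<p - 1. y i ^ 3) + b * (\<Sum>i<p - 1. y i ^ 2)"
    by (simp only: * sum.distrib sum_distrib_left)
  finally show ?thesis using s[of 2] s[of 3] p(1) by simp
qed

text \<open>\<open>b\<close> is the matrix of the inverse map; its columns are the preimages of the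
  unit vectors. The last conclusion is limited to the hyperplane, where \<open>A\<close> is
  injective.\<close>

lemma hyperplane_identification_inverse:
  fixes A :: "'p::prime_card mod_ring mat"
  assumes p: "p \<ge> 3" and A: "hyperplane_identification p A"
  obtains b where
    "\<And>i. i < p - 2 \<Longrightarrow> (\<Sum>k<p - 1. b k i) = 0"
    "\<And>i i'. i < p - 2 \<Longrightarrow> i' < p - 2 \<Longrightarrow>
      (\<Sum>k<p - 1. to_ac (A $$ (i', k)) * b k i) = (if i' = i then 1 else 0)"
    "\<And>P k. (\<Sum>l<p - 1. P l) = 0 \<Longrightarrow> k < p - 1 \<Longrightarrow>
      (\<Sum>i<p - 2. b k i * (\<Sum>l<p - 1. to_ac (A $$ (i, l)) * P l)) = P k"
proof -
  note One_nat_def [simp del]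
  let ?H = "sum_hyperplane p :: 'p mod_ring alg_closure vec set"
  let ?\<beta> = "\<lambda>P. map_mat to_ac A *\<^sub>v P"
  have Ad: "A \<in> carrier_mat (p - 2) (p - 1)" and bij: "bij_betw ?\<beta> ?H (carrier_vec (p - 2))"
    using A by (auto simp: hyperplane_identification_def)
  have \<beta>: "?\<beta> P = Matrix.vec (p - 2) (\<lambda>i. \<Sum>l<p - 1. to_ac (A $$ (i, l)) * P $ l)"
    if "P \<in> carrier_vec (p - 1)" for P
    using Ad that by (intro eq_vecI) (auto simp: scalar_prod_def lessThan_atLeast0)
  define b where "b k i = inv_into ?H ?\<beta> (unit_vec (p - 2) i) $ k" for k i
  have inv: "inv_into ?H ?\<beta> (unit_vec (p - 2) i) \<in> ?H"
    "?\<beta> (inv_into ?H ?\<beta> (unit_vec (p - 2) i)) = unit_vec (p - 2) i" if "i < p - 2" for i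
    using bij that by (auto simp: bij_betw_def inv_into_into f_inv_into_f)
  have 1: "(\<Sum>k<p - 1. b k i) = 0" if "i < p - 2" for i
    using inv(1)[OF that] by (simp add: b_def sum_hyperplane_def)
  have 2: "(\<Sum>k<p - 1. to_ac (A $$ (i', k)) * b k i) = (if i' = i then 1 else 0)"
    if "i < p - 2" "i' < p - 2" for i i'
  proof -
    have "unit_vec (p - 2) i = ?\<beta> (inv_into ?H ?\<beta> (unit_vec (p - 2) i))"
      using inv(2)[OF that(1)] by simp
    also have "\<dots> = Matrix.vec (p - 2) (\<lambda>i'. \<Sum>l<p - 1. to_ac (A $$ (i', l)) * b l i)"
      unfolding b_def using inv(1)[OF that(1)] by (intro \<beta>) (simp add: sum_hyperplane_def)
    finally have "Matrix.vec (p - 2) (\<lambda>i'. \<Sum>l<p - 1. to_ac (A $$ (i', l)) * b l i) = unit_vec (p - 2) i" ..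
    from arg_cong[OF this, of "\<lambda>u. vec_index u i'"] show ?thesis using that by simp
  qed
  have 3: "(\<Sum>i<p - 2. b k i * (\<Sum>l<p - 1. to_ac (A $$ (i, l)) * P l)) = P k"
    if P: "(\<Sum>l<p - 1. P l) = 0" and k: "k < p - 1" for P k
  proof -
    define R where "R i = (\<Sum>l<p - 1. to_ac (A $$ (i, l)) * P l)" for i
    \<comment> \<open>\<open>P'\<close> is the product of \<open>b\<close>, \<open>A\<close> and
      \<open>P\<close>. It lies in the hyperplane and has the same image as \<open>P\<close>, so
      injectivity makes the two equal.\<close>
    define P' where "P' k = (\<Sum>i<p - 2. b k i * R i)" for k
    have "(\<Sum>l<p - 1. to_ac (A $$ (i, l)) * P' l) = R i" if i: "i < p - 2" for i
    proof -
      have "(\<Sum>l<p - 1. to_ac (A $$ (i, l)) * P' l) =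
          (\<Sum>i'<p - 2. (\<Sum>l<p - 1. to_ac (A $$ (i, l)) * b l i') * R i')"
        unfolding P'_def sum_distrib_left sum_distrib_right
        by (subst sum.swap) (simp add: mult.assoc)
      also have "\<dots> = (\<Sum>i'<p - 2. if i' = i then R i' else 0)"
        by (intro sum.cong refl) (simp add: 2 i)
      also have "\<dots> = R i" using i by simp
      finally show ?thesis .
    qed
    then have "?\<beta> (Matrix.vec (p - 1) P') = ?\<beta> (Matrix.vec (p - 1) P)"
      unfolding \<beta>[OF vec_carrier] by (intro eq_vecI) (simp_all add: R_def)
    moreover have "(\<Sum>k<p - 1. P' k) = 0"
      unfolding P'_def by (subst sum.swap) (simp add: 1 flip: sum_distrib_right)
    then have "Matrix.vec (p - 1) P' \<in> ?H" "Matrix.vec (p - 1) P \<in> ?H"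
      using P by (auto simp: sum_hyperplane_def)
    ultimately have "Matrix.vec (p - 1) P' = Matrix.vec (p - 1) P"
      using bij by (auto simp: bij_betw_def inj_on_def)
    from arg_cong[OF this, of "\<lambda>u. vec_index u k"] show ?thesis
      using k by (simp add: P'_def R_def)
  qed
  show ?thesis by (rule that[OF 1 2 3])
qed

theorem theorem8p12:
  fixes p :: nat
    and A :: "'p::prime_card mod_ring mat"
    and \<Gamma> :: "'p mod_ring alg_closure vec set"
    and \<iota> :: "'p mod_ring alg_closure \<Rightarrow> 'f::field"
    and x :: "'f vec"
    and \<zeta> :: 'f
    and D :: "nat \<Rightarrow> 'f \<Rightarrow> 'f"
  assumes "p = CARD('p)" and "p \<ge> 7"
    and "hyperplane_identification p A"
    and "\<Gamma> = (\<lambda>P. map_mat to_ac A *\<^sub>v P) ` power_sum_curve p"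
    and "function_field_of (p - 3) \<Gamma> \<iota> x"
    and "separating_variable \<iota> \<zeta>"
    and "hasse_derivatives \<iota> \<zeta> D"
  shows "frobenius_nonclassical p (p - 3) D x"
proof -
  note One_nat_def [simp del]
  note p = assms(1,2) and ff = assms(5) and sep = assms(6)
  have hom: "field_hom \<iota>" using ff by (simp add: function_field_of_def)
  interpret hasse_family \<iota> \<zeta> D
    using hom assms(7) by (simp add: hasse_family_def hasse_family_axioms_def)
  have pr: "prime p" using p prime_card[where 'a = 'p] by simp
  have charK: "CHAR('p mod_ring alg_closure) = p" using p by simp
  have char: "CHAR('f) = p" using CHAR_field_hom[OF hom] charK by simp
  have dims: "p - 3 + 1 = p - 2" "{..p - 3} = {..<p - 2}" "\<And>j. j \<le> p - 3 \<longleftrightarrow> j < p - 2"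
    using p(2) by auto
  define a where "a i l = to_ac (A $$ (i, l))" for i l
  have "p \<ge> 3" using p(2) by simp
  from hyperplane_identification_inverse[OF this assms(3), folded a_def]
  obtain b where b0: "\<And>i. i < p - 2 \<Longrightarrow> (\<Sum>k<p - 1. b k i) = 0"
    and ab: "\<And>i i'. i < p - 2 \<Longrightarrow> i' < p - 2 \<Longrightarrow>
      (\<Sum>k<p - 1. a i' k * b k i) = (if i' = i then 1 else 0)"
    and ba: "\<And>P k. (\<Sum>l<p - 1. P l) = 0 \<Longrightarrow> k < p - 1 \<Longrightarrow>
      (\<Sum>i<p - 2. b k i * (\<Sum>l<p - 1. a i l * P l)) = P k"
    by blast
  \<comment> \<open>The identification is defined over the prime field, so the Frobenius map fixes
    its coefficients.\<close>
  have a_p: "a i l ^ p = a i l" for i l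
    using finite_field_power_card_eq_same[of "A $$ (i, l)"] p(1)
    by (simp add: a_def flip: to_ac_power)
  have \<Gamma>: "\<exists>Q\<in>power_sum_curve p. \<forall>i<p - 2. P $ i = (\<Sum>l<p - 1. a i l * Q $ l)" if "P \<in> \<Gamma>"
    for P :: "'p mod_ring alg_closure vec"
    using that assms(3) unfolding assms(4)
    by (auto simp: hyperplane_identification_def scalar_prod_def lessThan_atLeast0 a_def
        power_sum_curve_def intro!: bexI)
  have \<Gamma>I: "\<exists>P\<in>\<Gamma>. \<forall>i<p - 2. P $ i = (\<Sum>l<p - 1. a i l * Q $ l)" if "Q \<in> power_sum_curve p"
    for Q :: "'p mod_ring alg_closure vec"
    using that assms(3) unfolding assms(4)
    by (intro bexI[of _ "map_mat to_ac A *\<^sub>v Q"])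
      (auto simp: hyperplane_identification_def scalar_prod_def lessThan_atLeast0 a_def power_sum_curve_def)

  \<comment> \<open>A relation among the \<open>x $ i\<close> yields a linear form \<open>l\<close>
    in the original coordinates that vanishes on the curve and so has equal coefficients. Pairing it
    with column \<open>i\<close> of \<open>b\<close>, whose sum is zero, isolates
    \<open>c i\<close>.\<close>
  have indep: "\<forall>i<p - 2. c i = 0" if rel: "(\<Sum>i<p - 2. \<iota> (c i) * x $ i) = 0" for c
  proof -
    define l where "l k = (\<Sum>i<p - 2. c i * a i k)" for k
    have form: "form_values (p - 3 + 1) 1 \<iota> x (\<lambda>P. \<Sum>j<p - 2. c j * P $ j) (\<Sum>j<p - 2. \<iota> (c j) * x $ j)"
      using form_values_linear_power[of "p - 3 + 1" 1 x c] unfolding dims by simp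
    have van: "(\<Sum>i<p - 1. l i * Q $ i) = 0" if Q: "Q \<in> power_sum_curve p" for Q :: "'p mod_ring alg_closure vec"
    proof -
      obtain P :: "'p mod_ring alg_closure vec" where P: "P \<in> \<Gamma>" "\<And>i. i < p - 2 \<Longrightarrow> P $ i = (\<Sum>l<p - 1. a i l * Q $ l)"
        using \<Gamma>I[OF Q] by blast
      have "(\<Sum>i<p - 1. l i * Q $ i) = (\<Sum>i<p - 2. c i * (\<Sum>k<p - 1. a i k * Q $ k))"
        unfolding l_def sum_distrib_left sum_distrib_right by (subst sum.swap) (simp add: mult.assoc)
      also have "\<dots> = (\<Sum>j<p - 2. c j * P $ j)" by (simp add: P(2))
      also have "\<dots> = 0" using function_field_of_form[OF ff form] rel P(1) by blast
      finally show ?thesis .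
    qed
    have l: "l k = l 0" if "k < p - 1" for k
      using linear_form_vanishing_on_power_sum_curve[OF p(1) _ van that] p(2) by simp
    have "c i = 0" if i: "i < p - 2" for i
    proof -
      have "c i = (\<Sum>i'<p - 2. c i' * (if i' = i then 1 else 0))"
        by (rule sum_mult_delta(1)[OF i, symmetric])
      also have "\<dots> = (\<Sum>i'<p - 2. c i' * (\<Sum>k<p - 1. a i' k * b k i))"
        by (intro sum.cong refl) (simp add: ab i)
      also have "\<dots> = (\<Sum>k<p - 1. l k * b k i)"
        unfolding l_def sum_distrib_left sum_distrib_right by (subst sum.swap) (simp add: mult.assoc)
      also have "\<dots> = (\<Sum>k<p - 1. l 0 * b k i)"
      proof (intro sum.cong refl)
        fix k assume "k \<in> {..<p - 1}"
        then have "l k = l 0" by (intro l) simp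
        then show "l k * b k i = l 0 * b k i" by (rule arg_cong)
      qed
      also have "\<dots> = l 0 * (\<Sum>k<p - 1. b k i)" by (rule sum_distrib_left[symmetric])
      finally show ?thesis by (simp add: b0 i)
    qed
    then show ?thesis by blast
  qed

  \<comment> \<open>The coordinate functions of the original curve, recovered from \<open>x\<close>
    by the inverse identification.\<close>
  define y where "y k = (\<Sum>i<p - 2. \<iota> (b k i) * x $ i)" for k
  have s: "(\<Sum>k<p - 1. y k ^ d) = 0" if d: "1 \<le> d" "d \<le> p - 3" for d
  proof -
    have "form_values (p - 3 + 1) d \<iota> x (\<lambda>P. \<Sum>k<p - 1. (\<Sum>j<p - 2. b k j * P $ j) ^ d) (\<Sum>k<p - 1. y k ^ d)"
      unfolding y_def dims by (intro form_values_sum form_values_linear_power)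
    moreover have "(\<Sum>k<p - 1. (\<Sum>j<p - 2. b k j * P $ j) ^ d) = 0" if "P \<in> \<Gamma>"
      for P :: "'p mod_ring alg_closure vec"
    proof -
      obtain Q :: "'p mod_ring alg_closure vec" where Q: "Q \<in> power_sum_curve p" "\<And>i. i < p - 2 \<Longrightarrow> P $ i = (\<Sum>l<p - 1. a i l * Q $ l)"
        using \<Gamma> \<open>P \<in> \<Gamma>\<close> by blast
      have "1 \<in> {1..p - 3}" "d \<in> {1..p - 3}" using d by auto
      then have "(\<Sum>l<p - 1. (Q $ l) ^ 1) = 0" "(\<Sum>l<p - 1. (Q $ l) ^ d) = 0"
        using Q(1) unfolding power_sum_curve_def by blast+
      then show ?thesis using ba[of "\<lambda>l. Q $ l"] by (simp add: Q(2))
    qed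
    ultimately show ?thesis using function_field_of_form[OF ff] by blast
  qed
  have s1: "(\<Sum>k<p - 1. y k) = 0" using s[of 1] p(2) by simp
  \<comment> \<open>\<open>ba\<close> concerns vectors over K, whereas \<open>z\<close> lies in the
    function field. Testing \<open>ba\<close> on differences of unit vectors determines row
    \<open>k\<close> of the product of \<open>b\<close> and \<open>A\<close> up to a common summand,
    which is harmless because \<open>z\<close> has sum zero.\<close>
  have ba_hom: "(\<Sum>i<p - 2. \<iota> (b k i) * (\<Sum>l<p - 1. \<iota> (a i l) * z l)) = z k"
    if z: "(\<Sum>l<p - 1. z l) = 0" and k: "k < p - 1" for z k
  proof -
    define M where "M l = (\<Sum>i<p - 2. b k i * a i l)" for l
    have M: "M l - M 0 = (if l = k then 1 else 0) - (if 0 = k then 1 else 0)" if l: "l < p - 1" for l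
    proof -
      define e :: "nat \<Rightarrow> 'p mod_ring alg_closure"
        where "e j = (if j = l then 1 else 0) - (if j = 0 then 1 else 0)" for j
      have e: "(\<Sum>j<p - 1. f j * e j) = f l - f 0" for f
        unfolding e_def using l p(2) by (intro sum_mult_delta_diff) auto
      have "M l - M 0 = (\<Sum>i<p - 2. b k i * (\<Sum>j<p - 1. a i j * e j))"
        by (simp add: e M_def right_diff_distrib sum_subtractf)
      also have "\<dots> = e k" using e[of "\<lambda>_. 1"] by (intro ba k) simp
      finally show ?thesis by (cases "l = k"; cases "k = 0") (simp_all add: e_def)
    qed
    have "(\<Sum>i<p - 2. \<iota> (b k i) * (\<Sum>l<p - 1. \<iota> (a i l) * z l)) = (\<Sum>l<p - 1. \<iota> (M l) * z l)"
      unfolding M_def hom_sum hom_mult sum_distrib_left sum_distrib_right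
      by (subst sum.swap) (simp add: mult.assoc)
    also have "\<dots> = (\<Sum>l<p - 1. \<iota> (M l) * z l) - \<iota> (M 0) * (\<Sum>l<p - 1. z l)" by (simp add: z)
    also have "\<dots> = (\<Sum>l<p - 1. \<iota> (M l - M 0) * z l)"
      by (simp add: hom_minus left_diff_distrib sum_subtractf sum_distrib_left)
    also have "\<dots> = (\<Sum>l<p - 1. (if l = k then 1 else 0) * z l - (if 0 = k then 1 else 0) * z l)"
      by (intro sum.cong refl) (simp add: M hom_minus left_diff_distrib)
    also have "\<dots> = z k"
      unfolding sum_subtractf sum_mult_delta(2)[OF k] sum_distrib_left[symmetric] z by simp
    finally show ?thesis .
  qed
  have xy: "x $ i = (\<Sum>k<p - 1. \<iota> (a i k) * y k)" if i: "i < p - 2" for i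
  proof -
    have "(\<Sum>k<p - 1. \<iota> (a i k) * y k) = (\<Sum>i'<p - 2. \<iota> (\<Sum>k<p - 1. a i k * b k i') * x $ i')"
      unfolding y_def hom_sum hom_mult sum_distrib_left sum_distrib_right
      by (subst sum.swap) (simp add: mult.assoc)
    also have "\<dots> = (\<Sum>i'<p - 2. (if i' = i then x $ i' else 0))"
      by (intro sum.cong refl) (simp add: ab i)
    finally show ?thesis using i by simp
  qed
  have x0: "\<exists>i<p - 2. x $ i \<noteq> 0"
  proof (rule ccontr)
    assume "\<not> ?thesis"
    then have "\<forall>i<p - 2. (1 :: 'p mod_ring alg_closure) = 0"
      by (intro indep[of "\<lambda>_. 1"]) simp
    moreover have "0 < p - 2" using p(2) by simp
    ultimately show False by auto
  qed

  have "\<exists>\<mu>. frobenius_admissible p (p - 3) D x \<mu>"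
  proof (rule frobenius_admissible_exists)
    show "\<exists>j\<le>p - 3. x $ j \<noteq> 0" unfolding dims by (rule x0)
    show "\<forall>j\<le>p - 3. w j = 0" if "\<And>k. (\<Sum>j\<le>p - 3. w j * D k (x $ j)) = 0" for w
      using that unfolding dims by (intro hasse_rows_span[OF hasse_family_axioms sep indep])
  qed
  moreover have "det (frobenius_matrix p (p - 3) D x [0..<p - 3]) = 0"
  proof -
    let ?M = "frobenius_matrix p (p - 3) D x [0..<p - 3]"
    have M: "?M \<in> carrier_mat (p - 2) (p - 2)" by (simp add: frobenius_matrix_def dims)
    \<comment> \<open>The functional with coefficients \<open>y k ^ p\<close> on the hyperplane,
      expressed in the coordinates of PG(p - 3). It will be the relation among the columns.\<close>
    define c where "c i = (\<Sum>k<p - 1. y k ^ p * \<iota> (b k i))" for i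
    have frob: "(\<Sum>i\<in>I. f i) ^ p = (\<Sum>i\<in>I. f i ^ p)" for I and f :: "nat \<Rightarrow> 'f"
      by (rule freshmans_dream_sum) (simp_all only: char pr)
    have "0 < p" using p(2) by simp
    then have sp: "(\<Sum>k<p - 1. y k ^ p) = 0" by (simp only: frob[symmetric] s1 zero_power)
    have c_row: "(\<Sum>i<p - 2. c i * v i) = (\<Sum>k<p - 1. y k ^ p * (\<Sum>i<p - 2. \<iota> (b k i) * v i))" for v
      unfolding c_def sum_distrib_left sum_distrib_right by (subst sum.swap) (simp add: mult.assoc)
    have first_row: "(\<Sum>i<p - 2. c i * x $ i ^ p) = 0"
    proof -
      \<comment> \<open>By \<open>a_p\<close> the identification takes the vector of the
        \<open>y l ^ p\<close> to that of the \<open>x $ i ^ p\<close>.\<close>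
      have "x $ i ^ p = (\<Sum>l<p - 1. \<iota> (a i l) * y l ^ p)" if "i < p - 2" for i
        unfolding xy[OF that] frob power_mult_distrib hom_power[symmetric] a_p ..
      then have "(\<Sum>i<p - 2. \<iota> (b k i) * x $ i ^ p) = y k ^ p" if "k < p - 1" for k
        using ba_hom[OF sp that] by simp
      then have "(\<Sum>i<p - 2. c i * x $ i ^ p) = (\<Sum>k<p - 1. (y k ^ 2) ^ p)"
        unfolding c_row by (simp add: power2_eq_square power_mult_distrib)
      also have "\<dots> = (\<Sum>k<p - 1. y k ^ 2) ^ p"
        by (rule frob[symmetric])
      also have "(\<Sum>k<p - 1. y k ^ 2) = 0" using p(2) by (intro s) auto
      finally show ?thesis using \<open>0 < p\<close> by (simp add: zero_power)
    qed
    have hasse_row: "(\<Sum>i<p - 2. c i * D m (x $ i)) = 0" if m: "m < p" for m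
    proof -
      \<comment> \<open>The entries of \<open>b\<close> are constants, so Hasse derivatives commute
        with the inverse identification.\<close>
      have Dy: "(\<Sum>i<p - 2. \<iota> (b k i) * D m (x $ i)) = D m (y k)" for k
        by (simp add: y_def D_sum D_scale)
      \<comment> \<open>Only the term \<open>j = 0\<close> of the product rule survives, since
        derivatives of order 1, ..., p - 1 kill p-th powers.\<close>
      have "y k ^ p * D m (y k) = D m (y k ^ p * y k)" for k
      proof -
        have "D m (y k ^ p * y k) = (\<Sum>j\<le>m. (if j = 0 then y k ^ p else 0) * D (m - j) (y k))"
          unfolding D_mult using m by (intro sum.cong refl) (simp add: D_power_char[OF pr char])
        also have "\<dots> = (\<Sum>j\<in>{0}. y k ^ p * D (m - j) (y k))"
          by (intro sum.mono_neutral_cong_right) auto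
        finally show ?thesis by simp
      qed
      then have "(\<Sum>i<p - 2. c i * D m (x $ i)) = D m (\<Sum>k<p - 1. y k ^ (p + 1))"
        unfolding c_row Dy by (simp add: D_sum power_add)
      then show ?thesis using higher_power_sum_eq_0[OF p(2) char s] by simp
    qed
    \<comment> \<open>If the functional vanished, testing it on differences of unit vectors would
      make all \<open>y k ^ p\<close>, hence all \<open>y k\<close>, equal. Their sum
      \<open>of_nat (p - 1) * y 0\<close> is zero and p - 1 is invertible, so all \<open>y k\<close>
      and then all \<open>x $ i\<close> would vanish.\<close>
    have "\<exists>i<p - 2. c i \<noteq> 0"
    proof (rule ccontr)
      assume "\<not> ?thesis"
      then have c0: "c i = 0" if "i < p - 2" for i using that by blast
      have y0: "y l = y 0" if l: "l < p - 1" for l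
      proof -
        define z where "z j = (if j = l then 1 else 0) - (if j = 0 then 1 else (0 :: 'f))" for j
        have z: "(\<Sum>j<p - 1. g j * z j) = g l - g 0" for g
          unfolding z_def using l p(2) by (intro sum_mult_delta_diff) auto
        have "0 = (\<Sum>i<p - 2. c i * (\<Sum>j<p - 1. \<iota> (a i j) * z j))" by (simp add: c0)
        also have "\<dots> = (\<Sum>k<p - 1. y k ^ p * z k)"
          unfolding c_row using z[of "\<lambda>_. 1"] by (intro sum.cong refl) (simp add: ba_hom)
        also have "\<dots> = y l ^ p - y 0 ^ p" by (rule z)
        finally have "y l ^ p = y 0 ^ p" by simp
        moreover have "((y l - y 0) + y 0) ^ p = (y l - y 0) ^ p + y 0 ^ p"
          by (rule freshmans_dream) (simp_all only: char pr)
        ultimately have "(y l - y 0) ^ p = 0" by simp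
        then show ?thesis by simp
      qed
      have "of_nat (p - 1) * y 0 = (\<Sum>k<p - 1. y 0)" by simp
      also have "\<dots> = (\<Sum>k<p - 1. y k)" by (intro sum.cong refl y0[symmetric]) simp
      finally have "of_nat (p - 1) * y 0 = 0" by (simp only: s1)
      moreover have "of_nat (p - 1) \<noteq> (0 :: 'f)"
        using char p(2) by (auto simp: of_nat_eq_0_iff_char_dvd simp del: of_nat_diff dest: dvd_imp_le)
      ultimately have "y k = 0" if "k < p - 1" for k
        using y0[OF that] by (simp only: mult_eq_0_iff) simp
      then show False using x0 xy by auto
    qed
    \<comment> \<open>Row \<open>i > 0\<close> carries the derivative of order \<open>i - 1\<close>,
      which is at most p - 4 and so below p.\<close>
    moreover have "(\<Sum>j<p - 2. c j * ?M $$ (i, j)) = 0" if "i < p - 2" for i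
      using that first_row hasse_row[of "i - 1"]
      by (cases "i = 0") (auto simp: frobenius_matrix_def dims)
    ultimately show ?thesis unfolding det_eq_0_iff_columns_dependent[OF M] by blast
  qed
  ultimately show ?thesis by (rule frobenius_nonclassicalI)
qed

end
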